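(* Let $V$ be a finite dimensional vector space over a field $K$ of characteristic zero, and let $$(W, \hat N_1, H_1, \ldots, \hat N_r, H_r)$$ be an $\mathrm{sl}_2$-type on $V$ (that is, the $\mathrm{sl}_2$-type of some $r$-variable Deligne system on $V$). Then the set $\mathcal S$ of all $r$-variable Deligne systems $(W, N_1, \ldots, N_r; Y^r)$ of this $\mathrm{sl}_2$-type is an algebraic variety.
   Context: A grading of an increasing filtration $W$ of $V$ is a semisimple endomorphism $Y$ of $V$ with integer eigenvalues such that $W_k=\bigoplus_{j\le k}E_j(Y)$, with $E_j(Y)$ the $j$-eigenspace. For a nilpotent $N$ preserving $W$, the relative weight filtration $M=M(N,W)$ is the increasing filtration (unique if it exists) such that $N(M_k)\subseteq M_{k-2}$ for all $k$ and $N^\ell: Gr^M_{k+\ell}Gr^W_k\to Gr^M_{k-\ell}Gr^W_k$ is an isomorphism for all $k$ and all $\ell\ge 0$. An $r$-variable Deligne system $(W,N_1,\dots,N_r;Y^r)$ on $V$ consists of an increasing filtration $W=W^0$, endomorphisms $N_1,\dots,N_r$ and a grading $Y^r$ of $W^r$ such that: (a) $N_1,\dots,N_r$ are commuting nilpotent endomorphisms preserving $W^0$; (b) $W^j:=M(N_j,W^{j-1})$ exists for $j=1,\dots,r$; (c) for $1\le j\le r$, $0\le k<j-1$, $\ell\in\mathbb Z$ and $U=W^k_\ell$, the filtration $W^j|_U$ is the relative weight filtration of $N_j|_U$ with respect to $W^{j-1}|_U$; (d) $N_j(W^k_\ell)\subseteq W^k_\ell$ for all $j,k,\ell$, and $N_j(W^k_\ell)\subseteq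 W^k_{\ell-2}$ if $k\ge j$; (e) $Y^r$ preserves each $W^j$ and $[Y^r,N_j]=-2N_j$ for all $j$. A one-variable Deligne system is the case $r=1$, written $(W,N,Y)$. An $\mathrm{sl}_2$-pair $(N,H)$ consists of a nilpotent endomorphism $N$ and a grading $H$ of the monodromy weight filtration of $N$ (centered at $0$) with $[H,N]=-2N$. Deligne's construction: for a one-variable Deligne system $(W,N,Y)$, any grading $Y'$ of $W$ commuting with $Y$ gives a decomposition $N=N_0+N_{-1}+\cdots$ into $\mathrm{ad}(Y')$-eigencomponents, and with $H=Y-Y'$ there is a unique $N_0^+$ such that $(N_0^+,H,N_0)$ is an $\mathrm{sl}_2$-triple ($[H,N_0^+]=2N_0^+$, $[N_0^+,N_0]=H$, $[H,N_0]=-2N_0$). Deligne's theorem states that there is a unique grading $Y'=Y'(N,Y)$ of $W$ commuting with $Y$ such that $[N-N_0,N_0^+]=0$. For an $r$-variable Deligne system one sets $Y^{j-1}=Y'(N_j,Y^j)$ for $j=r,\dots,1$ (applied to the one-variable Deligne system $(W^{j-1},N_j,Y^j)$), lets $\hat N_j$ be the degree-zero part of $N_j$ with respect to $\mathrm{ad}\,Y^{j-1}$, and $H_j=Y^j-Y^{j-1}$; then $(\hat N_1,H_1),\dots,(\hat N_r,H_r)$ are commuting $\mathrm{sl}_2$-pairs. The $\mathrm{sl}_2$-type of the Deligne system $(W,N_1,\dots,N_r;Y^r)$ is the data consisting of $W$ and the pairs $(\hat N_1,H_1),\dots,(\hat N_r,H_r)$. *)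

theory Defs
  imports Complex_Main "HOL-Library.Set_Algebras" "HOL-Library.FuncSet"
begin

locale char0_vector_space = vector_space scale
  for scale :: "'a::field_char_0 \<Rightarrow> 'b::ab_group_add \<Rightarrow> 'b"
begin

abbreviation endo :: "('b \<Rightarrow> 'b) \<Rightarrow> bool" where
  "endo f \<equiv> Vector_Spaces.linear scale scale f"

definition bracket :: "('b \<Rightarrow> 'b) \<Rightarrow> ('b \<Rightarrow> 'b) \<Rightarrow> 'b \<Rightarrow> 'b" where
  "bracket f g = (\<lambda>v. f (g v) - g (f v))"

definition nilpotent_on :: "'b set \<Rightarrow> ('b \<Rightarrow> 'b) \<Rightarrow> bool" where
  "nilpotent_on U f \<longleftrightarrow> (\<exists>n. \<forall>u\<in>U. (f ^^ n) u = 0)"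

subsection \<open>Filtrations and gradings\<close>

text \<open>Filtrations are indexed by the integers and are exhaustive and separated. On a
  finite-dimensional space this means that they are constant outside a bounded range of indices.
  The filtered space \<open>U\<close> is allowed to be a subspace of the ambient space.\<close>

definition is_filtration :: "'b set \<Rightarrow> (int \<Rightarrow> 'b set) \<Rightarrow> bool" where
  "is_filtration U W \<longleftrightarrow> subspace U \<and> (\<forall>k. subspace (W k)) \<and> mono W \<and>
     (\<exists>a b. (\<forall>k\<le>a. W k = {0}) \<and> (\<forall>k\<ge>b. W k = U))"

definition preserves :: "('b \<Rightarrow> 'b) \<Rightarrow> (int \<Rightarrow> 'b set) \<Rightarrow> bool" where
  "preserves f W \<longleftrightarrow> (\<forall>k. f ` W k \<subseteq> W k)"

definition eigenspace :: "('b \<Rightarrow> 'b) \<Rightarrow> int \<Rightarrow> 'b set" where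
  "eigenspace f j = {v. f v = scale (of_int j) v}"

text \<open>An endomorphism is semisimple with integer eigenvalues iff the whole space is the sum of
  its integer eigenspaces; in characteristic zero such sums are automatically direct.\<close>

definition is_grading :: "(int \<Rightarrow> 'b set) \<Rightarrow> ('b \<Rightarrow> 'b) \<Rightarrow> bool" where
  "is_grading W Y \<longleftrightarrow> endo Y \<and>
     span (\<Union>j. eigenspace Y j) = UNIV \<and>
     (\<forall>k. W k = span (\<Union>j\<in>{..k}. eigenspace Y j))"

subsection \<open>Relative weight filtrations\<close>

text \<open>A quotient \<open>A / B\<close> is the set of cosets \<open>x + B\<close> with \<open>x \<in> A\<close>.  If \<open>f\<close> maps
  \<open>A\<close> to \<open>C\<close> and \<open>B\<close> to \<open>D\<close>, the induced map \<open>A / B \<rightarrow> C / D\<close> sends a coset \<open>X\<close> to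
  \<open>f(X) + D\<close>.\<close>

definition quotient_space :: "'b set \<Rightarrow> 'b set \<Rightarrow> 'b set set" where
  "quotient_space A B = (\<lambda>x. x +o B) ` A"

definition induces_iso :: "('b \<Rightarrow> 'b) \<Rightarrow> 'b set \<Rightarrow> 'b set \<Rightarrow> 'b set \<Rightarrow> 'b set \<Rightarrow> bool" where
  "induces_iso f A B C D \<longleftrightarrow> f ` A \<subseteq> C \<and> f ` B \<subseteq> D \<and>
     bij_betw (\<lambda>X. f ` X + D) (quotient_space A B) (quotient_space C D)"

text \<open>The filtration induced by \<open>M\<close> on \<open>Gr\<^sup>W\<^sub>k = W\<^sub>k / W\<^sub>k\<^sub>-\<^sub>1\<close> has the
  \<open>a\<close>-th step \<open>(M\<^sub>a \<inter> W\<^sub>k + W\<^sub>k\<^sub>-\<^sub>1) / W\<^sub>k\<^sub>-\<^sub>1\<close>, so that \<open>Gr\<^sup>M\<^sub>a Gr\<^sup>W\<^sub>k\<close> is the quotient of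
  \<open>induced_step M W k a\<close> by \<open>induced_step M W k (a - 1)\<close>.\<close>

definition induced_step ::
    "(int \<Rightarrow> 'b set) \<Rightarrow> (int \<Rightarrow> 'b set) \<Rightarrow> int \<Rightarrow> int \<Rightarrow> 'b set" where
  "induced_step M W k a = M a \<inter> W k + W (k - 1)"

text \<open>\<open>M\<close> is the relative weight filtration of \<open>N|\<^sub>U\<close> with respect to the filtration \<open>W\<close>
  of \<open>U\<close>.\<close>

definition is_relative_weight_filtration ::
    "'b set \<Rightarrow> ('b \<Rightarrow> 'b) \<Rightarrow> (int \<Rightarrow> 'b set) \<Rightarrow> (int \<Rightarrow> 'b set) \<Rightarrow> bool" where
  "is_relative_weight_filtration U N W M \<longleftrightarrow>
     is_filtration U W \<and> endo N \<and> nilpotent_on U N \<and> preserves N W \<and>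
     is_filtration U M \<and>
     (\<forall>k. N ` M k \<subseteq> M (k - 2)) \<and>
     (\<forall>k. \<forall>l::nat. induces_iso (N ^^ l)
        (induced_step M W k (k + int l)) (induced_step M W k (k + int l - 1))
        (induced_step M W k (k - int l)) (induced_step M W k (k - int l - 1)))"

definition relative_weight_filtration ::
    "('b \<Rightarrow> 'b) \<Rightarrow> (int \<Rightarrow> 'b set) \<Rightarrow> int \<Rightarrow> 'b set" where
  "relative_weight_filtration N W = (THE M. is_relative_weight_filtration UNIV N W M)"

subsection \<open>Deligne systems\<close>

text \<open>Families \<open>N\<^sub>1, \<dots>, N\<^sub>r\<close> are functions on the naturals of which only the values on
  \<open>{1..r}\<close> matter.\<close>

primrec weight_seq ::
    "(int \<Rightarrow> 'b set) \<Rightarrow> (nat \<Rightarrow> 'b \<Rightarrow> 'b) \<Rightarrow> nat \<Rightarrow> int \<Rightarrow> 'b set" where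
  "weight_seq W N 0 = W"
| "weight_seq W N (Suc j) = relative_weight_filtration (N (Suc j)) (weight_seq W N j)"

definition deligne_system ::
    "nat \<Rightarrow> (int \<Rightarrow> 'b set) \<Rightarrow> (nat \<Rightarrow> 'b \<Rightarrow> 'b) \<Rightarrow> ('b \<Rightarrow> 'b) \<Rightarrow> bool" where
  "deligne_system r W N Y \<longleftrightarrow>
     is_filtration UNIV W \<and>
     (\<forall>j\<in>{1..r}. endo (N j) \<and> nilpotent_on UNIV (N j) \<and> preserves (N j) W) \<and>
     (\<forall>i\<in>{1..r}. \<forall>j\<in>{1..r}. bracket (N i) (N j) = (\<lambda>v. 0)) \<and>
     (\<forall>j\<in>{1..r}. is_relative_weight_filtration UNIV (N j)
        (weight_seq W N (j - 1)) (weight_seq W N j)) \<and>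
     (\<forall>j\<in>{1..r}. \<forall>k l. k + 1 < j \<longrightarrow>
        is_relative_weight_filtration (weight_seq W N k l) (N j)
          (\<lambda>i. weight_seq W N (j - 1) i \<inter> weight_seq W N k l)
          (\<lambda>i. weight_seq W N j i \<inter> weight_seq W N k l)) \<and>
     (\<forall>j\<in>{1..r}. \<forall>k\<in>{0..r}. \<forall>l. N j ` weight_seq W N k l \<subseteq> weight_seq W N k l) \<and>
     (\<forall>j\<in>{1..r}. \<forall>k\<in>{j..r}. \<forall>l. N j ` weight_seq W N k l \<subseteq> weight_seq W N k (l - 2)) \<and>
     is_grading (weight_seq W N r) Y \<and>
     (\<forall>j\<in>{0..r}. preserves Y (weight_seq W N j)) \<and>
     (\<forall>j\<in>{1..r}. bracket Y (N j) = (\<lambda>v. scale (- 2) (N j v)))"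

subsection \<open>Deligne's construction and the type of a Deligne system\<close>

definition sl2_triple :: "('b \<Rightarrow> 'b) \<Rightarrow> ('b \<Rightarrow> 'b) \<Rightarrow> ('b \<Rightarrow> 'b) \<Rightarrow> bool" where
  "sl2_triple P H N \<longleftrightarrow> endo P \<and> endo H \<and> endo N \<and>
     bracket H P = (\<lambda>v. scale 2 (P v)) \<and>
     bracket P N = H \<and>
     bracket H N = (\<lambda>v. scale (- 2) (N v))"

text \<open>\<open>C d\<close> is the component of \<open>N\<close> in the \<open>d\<close>-eigenspace of \<open>ad Y\<close>.\<close>

definition is_ad_decomposition ::
    "('b \<Rightarrow> 'b) \<Rightarrow> ('b \<Rightarrow> 'b) \<Rightarrow> (int \<Rightarrow> 'b \<Rightarrow> 'b) \<Rightarrow> bool" where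
  "is_ad_decomposition Y N C \<longleftrightarrow>
     (\<forall>d. endo (C d) \<and> bracket Y (C d) = (\<lambda>v. scale (of_int d) (C d v))) \<and>
     finite {d. C d \<noteq> (\<lambda>v. 0)} \<and>
     N = (\<lambda>v. \<Sum>d | C d \<noteq> (\<lambda>v. 0). C d v)"

definition is_degree_zero_part :: "('b \<Rightarrow> 'b) \<Rightarrow> ('b \<Rightarrow> 'b) \<Rightarrow> ('b \<Rightarrow> 'b) \<Rightarrow> bool" where
  "is_degree_zero_part Y N N0 \<longleftrightarrow> (\<exists>C. is_ad_decomposition Y N C \<and> C 0 = N0)"

text \<open>The defining property of Deligne's grading \<open>Y' = Y'(N, Y)\<close> of \<open>W\<close>.  By Deligne's theorem
  exactly one \<open>Y'\<close> satisfies it when \<open>(W, N, Y)\<close> is a one-variable Deligne system, and \<open>N0\<close> and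
  \<open>P\<close> (the \<open>N\<^sub>0\<^sup>+\<close> of the construction) are determined by \<open>Y'\<close>; so this relation is the
  graph of the function \<open>(W, N, Y) \<mapsto> Y'(N, Y)\<close>.\<close>

definition is_deligne_grading ::
    "(int \<Rightarrow> 'b set) \<Rightarrow> ('b \<Rightarrow> 'b) \<Rightarrow> ('b \<Rightarrow> 'b) \<Rightarrow> ('b \<Rightarrow> 'b) \<Rightarrow> bool" where
  "is_deligne_grading W N Y Y' \<longleftrightarrow>
     is_grading W Y' \<and> bracket Y Y' = (\<lambda>v. 0) \<and>
     (\<exists>N0 P. is_degree_zero_part Y' N N0 \<and>
        sl2_triple P (\<lambda>v. Y v - Y' v) N0 \<and>
        bracket (\<lambda>v. N v - N0 v) P = (\<lambda>v. 0))"

text \<open>\<open>Ys j\<close> is \<open>Y\<^sup>j\<close>, obtained by descending recursion from \<open>Y\<^sup>r\<close>.\<close>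

definition has_sl2_type ::
    "nat \<Rightarrow> (int \<Rightarrow> 'b set) \<Rightarrow> (nat \<Rightarrow> 'b \<Rightarrow> 'b) \<Rightarrow> ('b \<Rightarrow> 'b) \<Rightarrow>
      (nat \<Rightarrow> 'b \<Rightarrow> 'b) \<Rightarrow> (nat \<Rightarrow> 'b \<Rightarrow> 'b) \<Rightarrow> bool" where
  "has_sl2_type r W N Y Nhat H \<longleftrightarrow>
     (\<exists>Ys. Ys r = Y \<and>
       (\<forall>j\<in>{1..r}.
          is_deligne_grading (weight_seq W N (j - 1)) (N j) (Ys j) (Ys (j - 1)) \<and>
          is_degree_zero_part (Ys (j - 1)) (N j) (Nhat j) \<and>
          H j = (\<lambda>v. Ys j v - Ys (j - 1) v)))"

definition is_sl2_type ::
    "nat \<Rightarrow> (int \<Rightarrow> 'b set) \<Rightarrow> (nat \<Rightarrow> 'b \<Rightarrow> 'b) \<Rightarrow> (nat \<Rightarrow> 'b \<Rightarrow> 'b) \<Rightarrow> bool" where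
  "is_sl2_type r W Nhat H \<longleftrightarrow>
     (\<exists>N Y. deligne_system r W N Y \<and> has_sl2_type r W N Y Nhat H)"

subsection \<open>Algebraic subsets of \<open>End(V)\<^sup>r \<times> End(V)\<close>\<close>

text \<open>A point of the affine space \<open>End(V)\<^sup>r \<times> End(V)\<close> is a pair \<open>((N\<^sub>1, \<dots>, N\<^sub>r), Y)\<close>; the family
  is normalised to be \<open>undefined\<close> outside \<open>{1..r}\<close>.\<close>

definition endo_tuples :: "nat \<Rightarrow> ((nat \<Rightarrow> 'b \<Rightarrow> 'b) \<times> ('b \<Rightarrow> 'b)) set" where
  "endo_tuples r = ({1..r} \<rightarrow>\<^sub>E {f. endo f}) \<times> {f. endo f}"

text \<open>The matrix coefficients \<open>\<phi> (N\<^sub>j v)\<close> and \<open>\<phi> (Y v)\<close>, for \<open>\<phi>\<close> a linear functional and \<open>v\<close> a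
  vector, span the linear functionals on \<open>End(V)\<^sup>r \<times> End(V)\<close>; hence the algebra they generate
  consists of the polynomials in the matrix entries.\<close>

inductive polynomial_fun :: "nat \<Rightarrow> ((nat \<Rightarrow> 'b \<Rightarrow> 'b) \<times> ('b \<Rightarrow> 'b) \<Rightarrow> 'a) \<Rightarrow> bool"
  for r :: nat where
  const: "polynomial_fun r (\<lambda>p. c)"
| coeff_N: "j \<in> {1..r} \<Longrightarrow> Vector_Spaces.linear scale (*) \<phi> \<Longrightarrow>
    polynomial_fun r (\<lambda>p. \<phi> (fst p j v))"
| coeff_Y: "Vector_Spaces.linear scale (*) \<phi> \<Longrightarrow> polynomial_fun r (\<lambda>p. \<phi> (snd p v))"
| add: "polynomial_fun r f \<Longrightarrow> polynomial_fun r g \<Longrightarrow> polynomial_fun r (\<lambda>p. f p + g p)"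
| mult: "polynomial_fun r f \<Longrightarrow> polynomial_fun r g \<Longrightarrow> polynomial_fun r (\<lambda>p. f p * g p)"

text \<open>Affine algebraic varieties, not required to be irreducible: common zero loci of
  polynomials.\<close>

definition algebraic_variety ::
    "nat \<Rightarrow> ((nat \<Rightarrow> 'b \<Rightarrow> 'b) \<times> ('b \<Rightarrow> 'b)) set \<Rightarrow> bool" where
  "algebraic_variety r S \<longleftrightarrow>
     (\<exists>F. (\<forall>f\<in>F. polynomial_fun r f) \<and> S = {p \<in> endo_tuples r. \<forall>f\<in>F. f p = 0})"

text \<open>Since \<open>W\<close> is part of the type, a system \<open>(W, N\<^sub>1, \<dots>, N\<^sub>r; Y)\<close> of the given type is recorded
  as the point \<open>((N\<^sub>1, \<dots>, N\<^sub>r), Y)\<close>.\<close>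

definition systems_of_sl2_type ::
    "nat \<Rightarrow> (int \<Rightarrow> 'b set) \<Rightarrow> (nat \<Rightarrow> 'b \<Rightarrow> 'b) \<Rightarrow> (nat \<Rightarrow> 'b \<Rightarrow> 'b) \<Rightarrow>
      ((nat \<Rightarrow> 'b \<Rightarrow> 'b) \<times> ('b \<Rightarrow> 'b)) set" where
  "systems_of_sl2_type r W Nhat H =
     {(N, Y) \<in> endo_tuples r. deligne_system r W N Y \<and> has_sl2_type r W N Y Nhat H}"

end

end

theory Submission
  imports Defs
begin

text \<open>
  The systems of a given type are the solutions of explicit polynomial equations in the matrix
  entries of \<open>N\<^sub>1, \<dots>, N\<^sub>r\<close> and \<open>Y\<close>.  Most of the defining conditions would visibly be polynomial if
  the filtrations \<open>W\<^sup>j\<close> and the operators completing \<open>(Nhat j, H j)\<close> to \<open>sl\<^sub>2\<close>-triples were constants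
  instead of depending on the system.  They are constants:

  \<^item> The gradings satisfy \<open>Y\<^sup>j = Y\<^sup>j\<^sup>-\<^sup>1 + H j\<close> with commuting \<open>Y\<^sup>j\<close> and \<open>Y\<^sup>j\<^sup>-\<^sup>1\<close>.  Consequently the
    filtration \<open>W\<^sup>j\<close> graded by \<open>Y\<^sup>j\<close> is spanned by the intersections of the \<open>W\<^sup>j\<^sup>-\<^sup>1 a\<close> with the
    \<open>b\<close>-eigenspaces of \<open>H j\<close> for \<open>a + b\<close> up to the given index, and by induction it only depends on
    \<open>W\<close> and \<open>H\<close> (lemmas \<open>filtration_from_commuting_grading\<close> and
    \<open>weight_seq_determined_by_type\<close>).

  \<^item> The raising operator of an \<open>sl\<^sub>2\<close>-triple is determined by the other two operators
    (\<open>sl2_raising_operator_unique\<close>).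

  With these data fixed, \<open>Y\<^sup>j = Y - H r - \<dots> - H (j + 1)\<close> is an affine function of \<open>Y\<close>.  It grades \<open>W\<^sup>j\<close>
  if and only if \<open>Y\<^sup>j - k\<close> maps each \<open>W\<^sup>j k\<close> to \<open>W\<^sup>j (k - 1)\<close> (\<open>is_gradingI\<close>,
  \<open>grading_acts_on_graded_piece\<close>).  As \<open>N j\<close> preserves \<open>W\<^sup>j\<^sup>-\<^sup>1\<close>, its degree-zero part is \<open>Nhat j\<close> if and
  only if \<open>Nhat j\<close> commutes with \<open>Y\<^sup>j\<^sup>-\<^sup>1\<close> and \<open>N j - Nhat j\<close> lowers the filtration \<open>W\<^sup>j\<^sup>-\<^sup>1\<close>
  (\<open>degree_zero_partI\<close>, \<open>degree_zero_partD\<close>).  All of these are equations of degree at most two, as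
  are the commutation relations.

  The remaining condition, that the \<open>W\<^sup>j\<close> are relative weight filtrations, asserts that certain
  maps are bijective, which is not a closed condition by itself.  It follows from the equations:
  on \<open>W\<^sup>j\<^sup>-\<^sup>1 k / W\<^sup>j\<^sup>-\<^sup>1 (k - 1)\<close> the operator \<open>N j\<close> of any solution induces the same map as \<open>Nhat j\<close>, and so
  the same map as the corresponding operator of one fixed system of the type.  The bijectivity
  for that system therefore carries over (\<open>relative_weight_filtration_transfer\<close>).  Finally, the
  uniqueness of relative weight filtrations (\<open>relative_weight_filtration_eqI\<close>) identifies the
  filtrations \<open>W\<^sup>j\<close> of a solution with the fixed ones.
\<close>

context char0_vector_space
begin

section \<open>Linear maps and eigenspaces\<close>

lemma endo_iff: "endo f \<longleftrightarrow> (\<forall>x y. f (x + y) = f x + f y) \<and> (\<forall>c x. f (scale c x) = scale c (f x))"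
  by (simp add: Vector_Spaces.linear_iff vector_space_axioms)

lemma endo_add: "endo f \<Longrightarrow> f (x + y) = f x + f y"
  and endo_scale: "endo f \<Longrightarrow> f (scale c x) = scale c (f x)"
  by (simp_all add: endo_iff)

lemma endo_zero: "endo f \<Longrightarrow> f 0 = 0"
  using endo_scale[of f 0 0] by simp

lemma endo_neg: "endo f \<Longrightarrow> f (- x) = - f x"
  using endo_scale[of f "-1" x] by simp

lemma endo_diff: "endo f \<Longrightarrow> f (x - y) = f x - f y"
  using endo_add[of f x "- y"] by (simp add: endo_neg)

lemma endo_sum: "endo f \<Longrightarrow> f (sum g A) = (\<Sum>i\<in>A. f (g i))"
  by (induction A rule: infinite_finite_induct) (simp_all add: endo_zero endo_add)

lemma endo_plus_fun: "endo f \<Longrightarrow> endo g \<Longrightarrow> endo (\<lambda>v. f v + g v)"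
  and endo_minus_fun: "endo f \<Longrightarrow> endo g \<Longrightarrow> endo (\<lambda>v. f v - g v)"
  and endo_scale_fun: "endo f \<Longrightarrow> endo (\<lambda>v. scale c (f v))"
  and endo_comp: "endo f \<Longrightarrow> endo g \<Longrightarrow> endo (\<lambda>v. f (g v))"
  and endo_ident: "endo (\<lambda>v. v)"
  and endo_const_zero: "endo (\<lambda>v. 0)"
  by (simp_all add: endo_iff scale_right_distrib scale_right_diff_distrib scale_left_commute)

lemma endo_sum_fun: "(\<And>i. i \<in> A \<Longrightarrow> endo (f i)) \<Longrightarrow> endo (\<lambda>v. \<Sum>i\<in>A. f i v)"
  by (induction A rule: infinite_finite_induct) (simp_all add: endo_const_zero endo_plus_fun)

lemma endo_bracket: "endo f \<Longrightarrow> endo g \<Longrightarrow> endo (bracket f g)"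
  by (simp add: bracket_def endo_minus_fun endo_comp)

lemma endo_funpow: "endo f \<Longrightarrow> endo (f ^^ n)"
  by (induction n) (simp_all add: id_def endo_ident endo_comp o_def)

lemma subspace_preimage: "endo f \<Longrightarrow> subspace U \<Longrightarrow> subspace {v. f v \<in> U}"
  by (simp add: subspace_def endo_zero endo_add endo_scale)

lemma subspace_direct_image: "endo f \<Longrightarrow> subspace U \<Longrightarrow> subspace (f ` U)"
  by (rule module_hom.subspace_image) (simp add: module_hom_iff_linear)

lemma image_span_subset:
  assumes "endo f" "subspace U" "\<And>x. x \<in> A \<Longrightarrow> f x \<in> U" "v \<in> span A"
  shows "f v \<in> U"
  using span_minimal[of A "{v. f v \<in> U}"] subspace_preimage[OF assms(1,2)] assms(3,4) by auto

lemma subspace_plus: "subspace A \<Longrightarrow> subspace B \<Longrightarrow> subspace (A + B)"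
proof -
  assume "subspace A" "subspace B"
  moreover have "A + B = {x + y |x y. x \<in> A \<and> y \<in> B}"
    by (auto simp: set_plus_def)
  ultimately show ?thesis
    by (simp add: subspace_sums)
qed

lemma bracket_zero_iff: "bracket f g = (\<lambda>v. 0) \<longleftrightarrow> (\<forall>v. f (g v) = g (f v))"
  by (auto simp: bracket_def fun_eq_iff)

lemma eigenspaceD: "v \<in> eigenspace Y j \<Longrightarrow> Y v = scale (of_int j) v"
  and eigenspaceI: "Y v = scale (of_int j) v \<Longrightarrow> v \<in> eigenspace Y j"
  by (simp_all add: eigenspace_def)

lemma subspace_eigenspace: "endo Y \<Longrightarrow> subspace (eigenspace Y j)"
  by (simp add: subspace_def eigenspace_def endo_zero endo_add endo_scale scale_right_distrib
      scale_left_commute)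

lemma commuting_maps_eigenspace:
  "endo X \<Longrightarrow> bracket Y X = (\<lambda>v. 0) \<Longrightarrow> v \<in> eigenspace Y j \<Longrightarrow> X v \<in> eigenspace Y j"
  by (simp add: bracket_zero_iff eigenspace_def endo_scale)

lemma ad_eigenvector_maps_eigenspace:
  assumes "endo X" "bracket Y X = (\<lambda>v. scale (of_int d) (X v))" "v \<in> eigenspace Y j"
  shows "X v \<in> eigenspace Y (j + d)"
proof -
  have "Y (X v) - X (Y v) = scale (of_int d) (X v)"
    using fun_cong[OF assms(2), of v] by (simp add: bracket_def)
  then show ?thesis
    using assms(1,3) by (simp add: eigenspace_def endo_scale scale_left_distrib algebra_simps)
qed

text \<open>Applying \<open>Y - e i\<close> to the sum removes the component with index \<open>i\<close> and multiplies the
  others by the nonzero numbers \<open>e j - e i\<close>, so induction on the number of components works.  For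
  \<open>S = {0}\<close> this is the independence of eigenvectors for different eigenvalues.\<close>

lemma eigencomponents_in_stable_subspace:
  assumes Y: "endo Y" and S: "subspace S" "\<And>v. v \<in> S \<Longrightarrow> Y v \<in> S"
    and "finite J" and "inj_on e J" and "\<And>i. i \<in> J \<Longrightarrow> x i \<in> eigenspace Y (e i)"
    and "(\<Sum>i\<in>J. x i) \<in> S" and "j \<in> J"
  shows "x j \<in> S"
  using assms(4-)
proof (induction J arbitrary: x j rule: finite_induct)
  case empty
  then show ?case by simp
next
  case (insert i J)
  let ?s = "\<Sum>k\<in>insert i J. x k"
  have xk: "Y (x k) = scale (of_int (e k)) (x k)" if "k \<in> insert i J" for k
    using insert.prems(2)[OF that] by (rule eigenspaceD)
  have "Y ?s - scale (of_int (e i)) ?s \<in> S"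
    using insert.prems(3) S by (intro subspace_diff subspace_scale) auto
  also have "Y ?s - scale (of_int (e i)) ?s = (\<Sum>k\<in>J. scale (of_int (e k - e i)) (x k))"
    using insert.hyps
    by (simp add: endo_add[OF Y] endo_sum[OF Y] xk scale_right_distrib scale_sum_right
        sum_subtractf[symmetric] scale_left_diff_distrib)
  finally have sum: "(\<Sum>k\<in>J. scale (of_int (e k - e i)) (x k)) \<in> S" .
  have J: "x k \<in> S" if k: "k \<in> J" for k
  proof -
    have "scale (of_int (e k - e i)) (x k) \<in> S"
      using insert.prems(1,2) sum k Y
      by (intro insert.IH[where x = "\<lambda>k. scale (of_int (e k - e i)) (x k)"])
        (auto intro: subspace_scale subspace_eigenspace simp: inj_on_def)
    then have "scale (inverse (of_int (e k - e i))) (scale (of_int (e k - e i)) (x k)) \<in> S"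
      by (rule subspace_scale[OF S(1)])
    moreover have "e k \<noteq> e i"
      using insert.prems(1) insert.hyps(2) k by (auto simp: inj_on_def)
    then have "(of_int (e k - e i) :: 'a) \<noteq> 0"
      by simp
    ultimately show ?thesis
      by (simp del: of_int_diff)
  qed
  have "?s - (\<Sum>k\<in>J. x k) \<in> S"
    by (rule subspace_diff[OF S(1) insert.prems(3) subspace_sum[OF S(1) J]])
  then have "x i \<in> S"
    using insert.hyps by simp
  then show ?case
    using J insert.prems(4) by auto
qed

lemma eigencomponents_zero:
  assumes "endo Y" "finite J" "inj_on e J" "\<And>i. i \<in> J \<Longrightarrow> x i \<in> eigenspace Y (e i)"
    and "(\<Sum>i\<in>J. x i) = 0" "j \<in> J"
  shows "x j = 0"
  using eigencomponents_in_stable_subspace[of Y "{0}" J e x j] assms by (simp add: endo_zero)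

lemma eigenspaces_disjoint:
  assumes "endo Y" "v \<in> eigenspace Y i" "v \<in> eigenspace Y j" "i \<noteq> j"
  shows "v = 0"
proof -
  have "scale (of_int i) v = scale (of_int j) v"
    using assms(2,3) by (simp add: eigenspace_def)
  then show ?thesis
    using assms(4) by simp
qed

lemma span_eigenspaces_decomposition:
  assumes Y: "endo Y" and "v \<in> span (\<Union>j\<in>A. eigenspace Y j)"
  obtains J x where "finite J" "J \<subseteq> A" "\<And>j. x j \<in> eigenspace Y j" "v = (\<Sum>j\<in>J. x j)"
proof -
  have "\<exists>J x. finite J \<and> J \<subseteq> A \<and> (\<forall>j. x j \<in> eigenspace Y j) \<and> v = (\<Sum>j\<in>J. x j)"
    using assms(2)
  proof (induction rule: span_induct_alt)
    case base
    show ?case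
      by (rule exI[of _ "{}"]) (auto intro!: exI[of _ "\<lambda>_. 0"] simp: eigenspace_def endo_zero[OF Y])
  next
    case (step c w y)
    then obtain i J x where i: "i \<in> A" "w \<in> eigenspace Y i" and
      J: "finite J" "J \<subseteq> A" "\<forall>j. x j \<in> eigenspace Y j" "y = (\<Sum>j\<in>J. x j)"
      by blast
    define x' where "x' j = (if j \<in> J then x j else 0) + (if j = i then scale c w else 0)" for j
    have "x' j \<in> eigenspace Y j" for j
      using J(3) i(2) subspace_eigenspace[OF Y]
      by (auto simp: x'_def intro: subspace_add subspace_scale subspace_0)
    moreover have "(\<Sum>j\<in>insert i J. if j \<in> J then x j else 0) = sum x J"
      using J(1) by (intro sum.mono_neutral_cong_right) auto
    then have "scale c w + y = (\<Sum>j\<in>insert i J. x' j)"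
      using J(1) by (simp add: x'_def sum.distrib J(4) add.commute del: sum.insert)
    ultimately show ?case
      using i(1) J(1,2) by (intro exI[of _ "insert i J"] exI[of _ x']) auto
  qed
  then show thesis
    using that by blast
qed

lemma stable_subspace_spanned_by_eigenvectors:
  assumes Y: "endo Y" "span (\<Union>j. eigenspace Y j) = UNIV"
    and S: "subspace S" "\<And>v. v \<in> S \<Longrightarrow> Y v \<in> S" and "v \<in> S"
  shows "v \<in> span (\<Union>j. eigenspace Y j \<inter> S)"
proof -
  obtain J x where J: "finite J" "\<And>j. x j \<in> eigenspace Y j" "v = (\<Sum>j\<in>J. x j)"
    using span_eigenspaces_decomposition[OF Y(1), of v UNIV] Y(2) by auto
  have "x j \<in> S" if "j \<in> J" for j
    using eigencomponents_in_stable_subspace[OF Y(1) S J(1), of "\<lambda>j. j" x] J that assms(5) by auto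
  then show ?thesis
    unfolding J(3) using J(2) by (intro span_sum span_base) auto
qed

section \<open>Gradings\<close>

lemma is_gradingD:
  assumes "is_grading W Y"
  shows "endo Y" and "span (\<Union>j. eigenspace Y j) = UNIV"
    and "W k = span (\<Union>j\<in>{..k}. eigenspace Y j)" and "subspace (W k)"
  using assms unfolding is_grading_def by (auto simp del: span_eq_iff)

lemma eigenspace_subset_filtration: "is_grading W Y \<Longrightarrow> v \<in> eigenspace Y j \<Longrightarrow> j \<le> k \<Longrightarrow> v \<in> W k"
  by (auto simp: is_gradingD(3) intro!: span_base)

lemma grading_preserves:
  assumes "is_grading W Y" "v \<in> W k"
  shows "Y v \<in> W k"
proof (rule image_span_subset[where A = "\<Union>j\<in>{..k}. eigenspace Y j" and f = Y])
  show "Y x \<in> W k" if "x \<in> (\<Union>j\<in>{..k}. eigenspace Y j)" for x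
    using that subspace_scale[OF is_gradingD(4)[OF assms(1)]] eigenspace_subset_filtration[OF assms(1)]
    by (metis UN_E atMost_iff eigenspaceD)
qed (use assms is_gradingD[OF assms(1)] in auto)

lemma grading_acts_on_graded_piece:
  assumes "is_grading W Y" "v \<in> W k"
  shows "Y v - scale (of_int k) v \<in> W (k - 1)"
proof (rule image_span_subset[where A = "\<Union>j\<in>{..k}. eigenspace Y j"
      and f = "\<lambda>v. Y v - scale (of_int k) v"])
  show "Y x - scale (of_int k) x \<in> W (k - 1)" if "x \<in> (\<Union>j\<in>{..k}. eigenspace Y j)" for x
  proof -
    from that obtain j where j: "j \<le> k" "x \<in> eigenspace Y j" by auto
    then have "Y x - scale (of_int k) x = scale (of_int j - of_int k) x"
      by (simp add: eigenspaceD scale_left_diff_distrib)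
    moreover have "x \<in> W (k - 1)" if "j \<noteq> k"
      using eigenspace_subset_filtration[OF assms(1) j(2), of "k - 1"] j(1) that by simp
    ultimately show ?thesis
      using is_gradingD(4)[OF assms(1)] by (cases "j = k") (auto intro: subspace_scale subspace_0)
  qed
qed (use assms is_gradingD[OF assms(1)] in \<open>auto intro: endo_minus_fun endo_scale_fun endo_ident\<close>)

lemma eigenspace_inter_filtration:
  assumes "is_grading W Y" "v \<in> eigenspace Y j" "v \<in> W k" "k < j"
  shows "v = 0"
proof -
  note Y = is_gradingD(1)[OF assms(1)]
  obtain J x where J: "finite J" "J \<subseteq> {..k}" "\<And>j. x j \<in> eigenspace Y j" "v = (\<Sum>j\<in>J. x j)"
    using span_eigenspaces_decomposition[OF Y, of v "{..k}"] assms(3)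
    unfolding is_gradingD(3)[OF assms(1)] by metis
  have j: "j \<notin> J" using J(2) assms(4) by auto
  \<comment> \<open>Moving \<open>v\<close> to the other side gives a vanishing sum of eigenvectors, in which \<open>- v\<close> is the
    component with eigenvalue \<open>j\<close>.\<close>
  define x' where "x' i = (if i = j then - v else x i)" for i
  have "(\<Sum>i\<in>J. x' i) = v"
    unfolding J(4) using j by (intro sum.cong) (auto simp: x'_def)
  then have "(\<Sum>i\<in>insert j J. x' i) = 0"
    using j J(1) by (simp add: x'_def)
  moreover have "x' i \<in> eigenspace Y i" for i
    using J(3) subspace_neg[OF subspace_eigenspace[OF Y] assms(2)] by (simp add: x'_def)
  ultimately have "x' j = 0"
    using J(1) eigencomponents_zero[OF Y, of "insert j J" "\<lambda>i. i" x' j] by simp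
  then show ?thesis by (simp add: x'_def)
qed

text \<open>Being a grading of \<open>W\<close> is a condition of membership in subspaces, linear in \<open>Y\<close>:
  \<open>Y\<close> acts on \<open>W k / W (k - 1)\<close> as multiplication by \<open>k\<close>.  Indeed \<open>Y - k\<close> is then invertible on
  \<open>W (k - 1)\<close>, where the eigenvalues are smaller than \<open>k\<close>, so each vector of \<open>W k\<close> can be corrected by
  one of \<open>W (k - 1)\<close> to an eigenvector.\<close>

lemma is_gradingI:
  assumes W: "is_filtration UNIV W" and Y: "endo Y"
    and act: "\<And>k v. v \<in> W k \<Longrightarrow> Y v - scale (of_int k) v \<in> W (k - 1)"
  shows "is_grading W Y"
proof -
  from W obtain a b where sub: "\<And>k. subspace (W k)" and mono: "mono W"
    and a: "\<And>k. k \<le> a \<Longrightarrow> W k = {0}" and b: "\<And>k. k \<ge> b \<Longrightarrow> W k = UNIV"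
    unfolding is_filtration_def by blast
  have below: "v \<in> W j" if v: "v \<in> eigenspace Y j" for v j
  proof -
    have "v \<in> W (max b j - int n)" if "int n \<le> max b j - j" for n
      using that
    proof (induction n)
      case 0
      then show ?case using b[of "max b j"] by simp
    next
      case (Suc n)
      define m where "m = max b j - int n"
      have m: "v \<in> W m" "j < m" "max b j - int (Suc n) = m - 1"
        using Suc by (auto simp: m_def)
      have "Y v - scale (of_int m) v = scale (of_int j - of_int m) v"
        using v by (simp add: eigenspaceD scale_left_diff_distrib)
      then have "scale (of_int j - of_int m) v \<in> W (m - 1)"
        using act[OF m(1)] by simp
      then have "scale (inverse (of_int j - of_int m)) (scale (of_int j - of_int m) v) \<in> W (m - 1)"
        by (rule subspace_scale[OF sub])
      then have "v \<in> W (m - 1)" using m(2) by simp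
      then show ?case by (simp only: m(3))
    qed
    from this[of "nat (max b j - j)"] show ?thesis by simp
  qed
  have "W k \<subseteq> span (\<Union>j\<in>{..k}. eigenspace Y j)" for k
  proof -
    have "W (a + int n) \<subseteq> span (\<Union>j\<in>{..a + int n}. eigenspace Y j)" for n
    proof (induction n)
      case 0
      show ?case using a[of a] by (auto intro: span_zero)
    next
      case (Suc n)
      define k where "k = a + int (Suc n)"
      let ?E = "\<lambda>k. span (\<Union>j\<in>{..k}. eigenspace Y j)"
      have IH: "W (k - 1) \<subseteq> ?E (k - 1)"
        using Suc by (simp add: k_def)
      let ?f = "\<lambda>w. Y w - scale (of_int k) w"
      have f: "endo ?f"
        by (intro endo_minus_fun endo_scale_fun endo_ident Y)
      have "(\<Union>j\<in>{..k - 1}. eigenspace Y j) \<subseteq> ?f ` ?E (k - 1)"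
      proof
        fix x assume "x \<in> (\<Union>j\<in>{..k - 1}. eigenspace Y j)"
        then obtain j where j: "j \<le> k - 1" "x \<in> eigenspace Y j" by auto
        let ?w = "scale (inverse (of_int j - of_int k)) x"
        have "?f ?w = scale (inverse (of_int j - of_int k)) (scale (of_int j - of_int k) x)"
          using j(2) by (simp add: endo_scale[OF Y] eigenspaceD scale_left_diff_distrib
              scale_right_diff_distrib mult.commute)
        also have "\<dots> = x" using j(1) by simp
        finally have "?f ?w = x" .
        moreover have "x \<in> ?E (k - 1)"
          using j by (intro span_base) auto
        then have "?w \<in> ?E (k - 1)"
          by (rule span_scale)
        ultimately show "x \<in> ?f ` ?E (k - 1)"
          by (metis (no_types, lifting) image_eqI)
      qed
      then have surj: "?E (k - 1) \<subseteq> ?f ` ?E (k - 1)"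
        by (intro span_minimal subspace_direct_image f) auto
      have "v \<in> ?E k" if v: "v \<in> W k" for v
      proof -
        from act[OF v] IH surj obtain w where w: "w \<in> ?E (k - 1)" "?f v = ?f w"
          by blast
        then have "v - w \<in> eigenspace Y k"
          by (intro eigenspaceI) (simp add: endo_diff[OF Y] scale_right_diff_distrib algebra_simps)
        then have "v - w \<in> ?E k" by (intro span_base) auto
        moreover have "?E (k - 1) \<subseteq> ?E k" by (intro span_mono UN_mono) auto
        ultimately have "(v - w) + w \<in> ?E k" using w by (intro span_add) auto
        then show ?thesis by simp
      qed
      then show ?case by (auto simp: k_def)
    qed
    from this[of "nat (k - a)"] show ?thesis
      using a[of k] by (cases "k \<le> a") (auto intro: span_zero)
  qed
  moreover have "span (\<Union>j\<in>{..k}. eigenspace Y j) \<subseteq> W k" for k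
    using below monoD[OF mono] by (intro span_minimal sub) blast
  ultimately have eq: "W k = span (\<Union>j\<in>{..k}. eigenspace Y j)" for k by blast
  have "UNIV = W b" using b[of b] by simp
  also have "\<dots> \<subseteq> span (\<Union>j. eigenspace Y j)"
    unfolding eq by (intro span_mono) auto
  finally show ?thesis
    unfolding is_grading_def using Y eq by auto
qed

text \<open>The finite set \<open>J\<close> exists because \<open>W\<close> has finitely many steps, which confines the
  eigenvalues of \<open>Y\<close> to a bounded interval.\<close>

lemma grading_projections:
  assumes W: "is_filtration UNIV W" and gr: "is_grading W Y"
  obtains \<pi> J where "finite J" "\<And>j. endo (\<pi> j)" "\<And>j v. \<pi> j v \<in> eigenspace Y j"
    "\<And>j v. j \<notin> J \<Longrightarrow> \<pi> j v = 0" "\<And>v. v = (\<Sum>j\<in>J. \<pi> j v)"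
    "\<And>i j v. v \<in> eigenspace Y i \<Longrightarrow> \<pi> j v = (if i = j then v else 0)"
proof -
  note Y = is_gradingD(1)[OF gr]
  from W obtain a b where a: "\<And>k. k \<le> a \<Longrightarrow> W k = {0}" and b: "\<And>k. k \<ge> b \<Longrightarrow> W k = UNIV"
    unfolding is_filtration_def by blast
  define J where "J = {a..b}"
  have outside: "x = 0" if "j \<notin> J" "x \<in> eigenspace Y j" for j x
  proof (cases "j \<le> a")
    case True
    then show ?thesis using that a[of j] eigenspace_subset_filtration[OF gr, of x j j] by auto
  next
    case False
    then have "b < j" using that by (auto simp: J_def)
    then show ?thesis using eigenspace_inter_filtration[OF gr that(2), of b] b[of b] by auto
  qed
  have "\<exists>x. (\<forall>j. x j \<in> eigenspace Y j) \<and> v = (\<Sum>j\<in>J. x j)" for v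
  proof -
    obtain I x where I: "finite I" "\<And>j. x j \<in> eigenspace Y j" "v = (\<Sum>j\<in>I. x j)"
      using span_eigenspaces_decomposition[OF Y, of v UNIV] is_gradingD(2)[OF gr] by auto
    define x' where "x' j = (if j \<in> I then x j else 0)" for j
    have x': "x' j \<in> eigenspace Y j" for j
      using I(2) subspace_0[OF subspace_eigenspace[OF Y]] by (simp add: x'_def)
    have "v = (\<Sum>j\<in>I \<union> J. x' j)"
      using I(1) unfolding I(3) by (intro sum.mono_neutral_cong_left) (auto simp: x'_def J_def)
    also have "\<dots> = (\<Sum>j\<in>J. x' j)"
      using I(1) outside x' by (intro sum.mono_neutral_right) (auto simp: J_def)
    finally show ?thesis using x' by blast
  qed
  then obtain p where p: "\<And>v j. p v j \<in> eigenspace Y j" "\<And>v. v = (\<Sum>j\<in>J. p v j)"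
    by metis
  have uniq: "p v j = x j" if "\<And>j. x j \<in> eigenspace Y j" "v = (\<Sum>j\<in>J. x j)" for v x j
  proof (cases "j \<in> J")
    case True
    have "(\<Sum>j\<in>J. p v j - x j) = 0"
      using that(2) p(2)[of v] by (simp add: sum_subtractf)
    then have "p v j - x j = 0"
      using that(1) p(1) subspace_eigenspace[OF Y] True
      by (intro eigencomponents_zero[OF Y, of J "\<lambda>j. j" "\<lambda>j. p v j - x j"])
        (auto simp: J_def intro: subspace_diff)
    then show ?thesis by simp
  next
    case False
    then show ?thesis using outside p(1) that(1) by metis
  qed
  show thesis
  proof (rule that[of J "\<lambda>j v. p v j"])
    show "finite J" by (simp add: J_def)
    show "p v j = 0" if "j \<notin> J" for j v using outside[OF that p(1)] .
    show "v = (\<Sum>j\<in>J. p v j)" for v by (rule p(2))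
    show "p v j \<in> eigenspace Y j" for v j by (rule p(1))
    show "p v j = (if i = j then v else 0)" if v: "v \<in> eigenspace Y i" for i j v
    proof (rule uniq)
      show "(if i = j then v else 0) \<in> eigenspace Y j" for j
        using v subspace_0[OF subspace_eigenspace[OF Y]] by auto
      show "v = (\<Sum>j\<in>J. if i = j then v else 0)"
        using outside[OF _ v] by (auto simp: J_def)
    qed
    show "endo (\<lambda>v. p v j)" for j
      unfolding endo_iff
    proof (intro conjI allI)
      show "p (v + w) j = p v j + p w j" for v w
        using subspace_add[OF subspace_eigenspace[OF Y] p(1) p(1)]
      proof (rule uniq)
        show "v + w = (\<Sum>j\<in>J. p v j + p w j)"
          using arg_cong2[OF p(2)[of v] p(2)[of w], of "(+)"] by (simp only: sum.distrib)
      qed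
      show "p (scale c v) j = scale c (p v j)" for c v
        using subspace_scale[OF subspace_eigenspace[OF Y] p(1)]
      proof (rule uniq)
        show "scale c v = (\<Sum>j\<in>J. scale c (p v j))"
          using arg_cong[OF p(2)[of v], of "scale c"] by (simp only: scale_sum_right)
      qed
    qed
  qed
qed

section \<open>Relative weight filtrations\<close>

lemma image_coset_plus:
  assumes f: "endo f" and "subspace B" "subspace D" "f ` B \<subseteq> D"
  shows "f ` (x +o B) + D = f x +o D"
proof (intro set_eqI iffI)
  fix z assume "z \<in> f ` (x +o B) + D"
  then obtain b d where "b \<in> B" "d \<in> D" "z = f (x + b) + d"
    by (auto simp: elt_set_plus_def set_plus_def)
  then show "z \<in> f x +o D"
    using assms by (auto simp: elt_set_plus_def endo_add add.assoc
        intro!: bexI[of _ "f b + d"] subspace_add)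
next
  fix z assume "z \<in> f x +o D"
  then obtain d where d: "d \<in> D" "z = f (x + 0) + d"
    by (auto simp: elt_set_plus_def)
  have "x + 0 \<in> x +o B"
    using subspace_0[OF assms(2)] by (rule set_plus_intro2)
  then show "z \<in> f ` (x +o B) + D"
    unfolding d(2) using d(1) by (intro set_plus_intro imageI)
qed

lemma coset_eq_iff: "subspace D \<Longrightarrow> x +o D = y +o D \<longleftrightarrow> x - y \<in> D"
proof
  assume D: "subspace D" and eq: "x +o D = y +o D"
  have "x + 0 \<in> x +o D" using subspace_0[OF D] by (rule set_plus_intro2)
  then show "x - y \<in> D" by (simp add: eq set_minus_plus)
next
  assume D: "subspace D" and "x - y \<in> D"
  have "a +o D \<subseteq> b +o D" if ab: "a - b \<in> D" for a b
  proof
    fix z assume "z \<in> a +o D"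
    then have "z - a \<in> D" by (rule set_plus_imp_minus)
    then have "(z - a) + (a - b) \<in> D" using ab by (rule subspace_add[OF D])
    then show "z \<in> b +o D" by (intro set_minus_imp_plus) simp
  qed
  moreover have "y - x \<in> D"
    using subspace_neg[OF D \<open>x - y \<in> D\<close>] by simp
  ultimately show "x +o D = y +o D" using \<open>x - y \<in> D\<close> by blast
qed

lemma induces_iso_injD:
  assumes "induces_iso f A B C D" "endo f" "subspace A" "subspace B" "subspace D" "x \<in> A" "f x \<in> D"
  shows "x \<in> B"
proof -
  from assms(1) have fB: "f ` B \<subseteq> D"
    and inj: "inj_on (\<lambda>X. f ` X + D) (quotient_space A B)"
    by (auto simp: induces_iso_def bij_betw_def)
  note im = image_coset_plus[OF assms(2,4,5) fB]
  have "f x - f 0 \<in> D"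
    using assms(7) endo_zero[OF assms(2)] by simp
  then have "f ` (x +o B) + D = f ` (0 +o B) + D"
    unfolding im using iffD2[OF coset_eq_iff[OF assms(5)]] by blast
  moreover have "x +o B \<in> quotient_space A B"
    unfolding quotient_space_def using assms(6) by (rule imageI)
  moreover have "0 +o B \<in> quotient_space A B"
    unfolding quotient_space_def using subspace_0[OF assms(3)] by (rule imageI)
  ultimately have "x +o B = 0 +o B"
    by (rule inj_onD[OF inj, where x = "x +o B" and y = "0 +o B"])
  then show ?thesis
    unfolding coset_eq_iff[OF assms(4)] by simp
qed

lemma induces_iso_surjD:
  assumes "induces_iso f A B C D" "endo f" "subspace B" "subspace D" "y \<in> C"
  obtains x where "x \<in> A" "y - f x \<in> D"
proof -
  from assms(1) have fB: "f ` B \<subseteq> D"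
    and surj: "(\<lambda>X. f ` X + D) ` quotient_space A B = quotient_space C D"
    by (auto simp: induces_iso_def bij_betw_def)
  have "y +o D \<in> quotient_space C D"
    using assms(5) by (simp add: quotient_space_def)
  then have "y +o D \<in> (\<lambda>x. f ` (x +o B) + D) ` A"
    unfolding surj[symmetric] by (simp add: quotient_space_def image_image)
  then obtain x where "x \<in> A" "y +o D = f ` (x +o B) + D" ..
  then have "x \<in> A" "y - f x \<in> D"
    unfolding image_coset_plus[OF assms(2-4) fB] coset_eq_iff[OF assms(4)] .
  then show thesis by (rule that)
qed

lemma induces_iso_cong:
  assumes "induces_iso f A B C D" "endo f" "endo g" "subspace B" "subspace D"
    and "g ` A \<subseteq> C" "g ` B \<subseteq> D" and "\<And>x. x \<in> A \<Longrightarrow> g x - f x \<in> D"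
  shows "induces_iso g A B C D"
proof -
  from assms(1) have fB: "f ` B \<subseteq> D"
    and bij: "bij_betw (\<lambda>X. f ` X + D) (quotient_space A B) (quotient_space C D)"
    by (auto simp: induces_iso_def)
  have "bij_betw (\<lambda>X. g ` X + D) (quotient_space A B) (quotient_space C D)"
  proof (rule iffD1[OF bij_betw_cong bij])
    fix X assume "X \<in> quotient_space A B"
    then obtain x where x: "x \<in> A" "X = x +o B" by (auto simp: quotient_space_def)
    show "f ` X + D = g ` X + D"
      using assms(8)[OF x(1)] coset_eq_iff[OF assms(5), of "g x" "f x"]
      unfolding x(2) image_coset_plus[OF assms(2,4,5) fB] image_coset_plus[OF assms(3-5,7)] by simp
  qed
  then show ?thesis using assms(6,7) by (simp add: induces_iso_def)
qed

lemma is_filtrationD: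
  assumes "is_filtration U W"
  shows "subspace (W k)" and "j \<le> k \<Longrightarrow> W j \<subseteq> W k" and "W k \<subseteq> U"
    and "\<exists>a. \<forall>k\<le>a. W k = {0}" and "\<exists>b. \<forall>k\<ge>b. W k = U"
proof -
  show sub: "W j \<subseteq> W k" if "j \<le> k" for j k
    using assms that by (auto simp: is_filtration_def dest: monoD)
  show "subspace (W k)" "\<exists>a. \<forall>k\<le>a. W k = {0}" and b: "\<exists>b. \<forall>k\<ge>b. W k = U"
    using assms unfolding is_filtration_def by blast+
  from b obtain b where "\<forall>k\<ge>b. W k = U" ..
  then show "W k \<subseteq> U"
    using sub[of k "max b k"] by auto
qed

lemma relative_weight_filtrationD:
  assumes "is_relative_weight_filtration U N W M"
  shows "is_filtration U W" and "is_filtration U M" and "endo N"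
    and "v \<in> W k \<Longrightarrow> N v \<in> W k" and "v \<in> M k \<Longrightarrow> N v \<in> M (k - 2)"
    and "induces_iso (N ^^ l)
        (induced_step M W k (k + int l)) (induced_step M W k (k + int l - 1))
        (induced_step M W k (k - int l)) (induced_step M W k (k - int l - 1))"
  using assms by (simp_all add: is_relative_weight_filtration_def preserves_def image_subset_iff)

lemma subspace_induced_step:
  "is_filtration U W \<Longrightarrow> is_filtration U M \<Longrightarrow> subspace (induced_step M W k a)"
  unfolding induced_step_def by (intro subspace_plus subspace_inter is_filtrationD(1))

lemma induced_stepE:
  assumes "x \<in> induced_step M W k a"
  obtains m w where "m \<in> M a" "m \<in> W k" "w \<in> W (k - 1)" "x = m + w"
  using assms by (auto simp: induced_step_def set_plus_def)

lemma induced_stepI: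
  "m \<in> M a \<Longrightarrow> m \<in> W k \<Longrightarrow> w \<in> W (k - 1) \<Longrightarrow> m + w \<in> induced_step M W k a"
  unfolding induced_step_def by (intro set_plus_intro IntI)

lemma induced_stepI1:
  "is_filtration U W \<Longrightarrow> m \<in> M a \<Longrightarrow> m \<in> W k \<Longrightarrow> m \<in> induced_step M W k a"
  and induced_stepI2:
  "is_filtration U M \<Longrightarrow> is_filtration U W \<Longrightarrow> w \<in> W (k - 1) \<Longrightarrow> w \<in> induced_step M W k a"
  using induced_stepI[of m M a W k 0] induced_stepI[of 0 M a W k w]
  by (auto simp: subspace_0 is_filtrationD(1))

lemma funpow_stable: "(\<And>v. v \<in> A \<Longrightarrow> N v \<in> A) \<Longrightarrow> v \<in> A \<Longrightarrow> (N ^^ l) v \<in> A"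
  by (induction l) auto

lemma funpow_shift:
  fixes M :: "int \<Rightarrow> 'b set"
  assumes "\<And>k v. v \<in> M k \<Longrightarrow> N v \<in> M (k - 2)"
  shows "v \<in> M k \<Longrightarrow> j = k - 2 * int l \<Longrightarrow> (N ^^ l) v \<in> M j"
proof (induction l arbitrary: j)
  case (Suc l)
  then have "N ((N ^^ l) v) \<in> M (k - 2 * int l - 2)"
    by (intro assms) simp
  moreover have "j = k - 2 * int l - 2"
    using Suc.prems(2) by simp
  ultimately show ?case by simp
qed simp

text \<open>The injectivity of the maps \<open>N ^ m\<close> between graded pieces lifts from \<open>W k / W (k - 1)\<close> to
  \<open>W k\<close>: the error term lies in \<open>W (k - 1)\<close>, and a further application of \<open>N\<close> puts it into the
  situation of the lemma with \<open>k - 1\<close> and \<open>m + 1\<close> in place of \<open>k\<close> and \<open>m\<close>.\<close>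

lemma relative_weight_filtration_injectivity:
  assumes M: "is_relative_weight_filtration U N W M"
    and "x \<in> M (k + int m)" "x \<in> W k" "(N ^^ m) x \<in> M (k - int m - 1)"
  shows "x \<in> M (k + int m - 1)"
proof -
  note [simp] = endo_zero[OF relative_weight_filtrationD(3)[OF M]]
  note FW = relative_weight_filtrationD(1)[OF M] and FM = relative_weight_filtrationD(2)[OF M]
    and N = relative_weight_filtrationD(3)[OF M]
    and NW = relative_weight_filtrationD(4)[OF M] and NM = relative_weight_filtrationD(5)[OF M]
    and iso = relative_weight_filtrationD(6)[OF M]
  obtain a where a: "\<And>k. k \<le> a \<Longrightarrow> W k = {0}" using is_filtrationD(4)[OF FW] by blast
  have "x \<in> M (k + int m - 1)"
    if "x \<in> M (k + int m)" "x \<in> W k" "(N ^^ m) x \<in> M (k - int m - 1)" "k \<le> a + int n" for n k m x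
    using that
  proof (induction n arbitrary: k m x)
    case 0
    then show ?case using a[of k] subspace_0[OF is_filtrationD(1)[OF FM]] by auto
  next
    case (Suc n)
    have "(N ^^ m) x \<in> W k" using NW Suc.prems(2) by (rule funpow_stable)
    then have "(N ^^ m) x \<in> induced_step M W k (k - int m - 1)"
      using Suc.prems(3) by (intro induced_stepI1[OF FW])
    moreover have "x \<in> induced_step M W k (k + int m)"
      using Suc.prems by (intro induced_stepI1[OF FW])
    moreover note subspace_induced_step[OF FW FM]
    ultimately have "x \<in> induced_step M W k (k + int m - 1)"
      using induces_iso_injD[OF iso[of m k] endo_funpow[OF N], of x] by simp
    then obtain x' w where x': "x' \<in> M (k + int m - 1)" "x' \<in> W k" "w \<in> W (k - 1)" "x = x' + w"
      by (rule induced_stepE)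
    have w: "w = x - x'" using x'(4) by simp
    have "x' \<in> M (k + int m)"
      using x'(1) is_filtrationD(2)[OF FM, of "k + int m - 1" "k + int m"] by auto
    then have "w \<in> M (k - 1 + int (Suc m))"
      unfolding w using Suc.prems(1) subspace_diff[OF is_filtrationD(1)[OF FM]] by simp
    moreover have "(N ^^ Suc m) w \<in> M (k - 1 - int (Suc m) - 1)"
    proof -
      have "N ((N ^^ m) x) \<in> M (k - int m - 3)"
        using NM[OF Suc.prems(3)] by (simp add: algebra_simps)
      moreover have "(N ^^ Suc m) x' \<in> M (k - int m - 3)"
        by (rule funpow_shift[of M N, OF NM x'(1)]) auto
      ultimately have "N ((N ^^ m) x) - (N ^^ Suc m) x' \<in> M (k - int m - 3)"
        by (rule subspace_diff[OF is_filtrationD(1)[OF FM]])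
      also have "N ((N ^^ m) x) - (N ^^ Suc m) x' = (N ^^ Suc m) w"
        unfolding w endo_diff[OF endo_funpow[OF N]] by simp
      finally show ?thesis by (simp add: algebra_simps)
    qed
    ultimately have "w \<in> M (k - 1 + int (Suc m) - 1)"
      using x'(3) Suc.prems(4) by (intro Suc.IH) auto
    then show ?case
      unfolding x'(4) using x'(1) by (intro subspace_add[OF is_filtrationD(1)[OF FM]]) auto
  qed
  from this[of x k m "nat (k - a)"] show ?thesis using assms(2-4) by simp
qed

text \<open>Surjectivity lifts as well: it first gives \<open>y = (N ^ m) x + d\<close> modulo \<open>W (k - 1)\<close> with \<open>d\<close> in a
  smaller step of \<open>M\<close>, and by induction \<open>d\<close> is of the form \<open>(N ^ (m + 1)) x'\<close> modulo \<open>W (k - 1)\<close>.\<close>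

lemma relative_weight_filtration_surjectivity:
  assumes M: "is_relative_weight_filtration U N W M"
    and "y \<in> M (k - int m)" "y \<in> W k"
  obtains x where "x \<in> M (k + int m)" "x \<in> W k"
    "y - (N ^^ m) x \<in> M (k - int m)" "y - (N ^^ m) x \<in> W (k - 1)"
proof -
  note FW = relative_weight_filtrationD(1)[OF M] and FM = relative_weight_filtrationD(2)[OF M]
    and N = relative_weight_filtrationD(3)[OF M]
    and NW = relative_weight_filtrationD(4)[OF M] and NM = relative_weight_filtrationD(5)[OF M]
    and iso = relative_weight_filtrationD(6)[OF M]
  note SW = is_filtrationD(1)[OF FW] and SM = is_filtrationD(1)[OF FM]
  obtain b where b: "\<And>k. k \<le> b \<Longrightarrow> M k = {0}" using is_filtrationD(4)[OF FM] by blast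
  have diff: "y - (N ^^ m) x \<in> M (k - int m)"
    if "y \<in> M (k - int m)" "x \<in> M (k + int m)" for x y m
    using that by (intro subspace_diff[OF SM] funpow_shift[of M N, OF NM, where k = "k + int m"]) auto
  have "\<exists>x. x \<in> M (k + int m) \<and> x \<in> W k \<and> y - (N ^^ m) x \<in> W (k - 1)"
    if "y \<in> M (k - int m)" "y \<in> W k" "k - int m \<le> b + int n" for n m y
    using that
  proof (induction n arbitrary: m y)
    case 0
    then have "y = 0" using b[of "k - int m"] by auto
    then show ?case
      using endo_zero[OF endo_funpow[OF N]] by (intro exI[of _ 0]) (simp add: subspace_0 SM SW)
  next
    case (Suc n)
    have "y \<in> induced_step M W k (k - int m)"
      using Suc.prems by (intro induced_stepI1[OF FW])
    then obtain x where x: "x \<in> induced_step M W k (k + int m)"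
      "y - (N ^^ m) x \<in> induced_step M W k (k - int m - 1)"
      using induces_iso_surjD[OF iso[of m k] endo_funpow[OF N] subspace_induced_step[OF FW FM]
          subspace_induced_step[OF FW FM]] by blast
    obtain x1 w1 where x1: "x1 \<in> M (k + int m)" "x1 \<in> W k" "w1 \<in> W (k - 1)" "x = x1 + w1"
      using x(1) by (rule induced_stepE)
    obtain d w where d: "d \<in> M (k - int m - 1)" "d \<in> W k" "w \<in> W (k - 1)" "y - (N ^^ m) x = d + w"
      using x(2) by (rule induced_stepE)
    obtain x2 where x2: "x2 \<in> M (k + int (Suc m))" "x2 \<in> W k" "d - (N ^^ Suc m) x2 \<in> W (k - 1)"
    proof -
      have "d \<in> M (k - int (Suc m))" using d(1) by (simp add: algebra_simps)
      then show thesis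
        using Suc.IH[of d "Suc m"] d(2) Suc.prems(3) that by auto
    qed
    have "N x2 \<in> M (k + int m - 1)" using NM[OF x2(1)] by simp
    then have "N x2 \<in> M (k + int m)"
      using is_filtrationD(2)[OF FM, of "k + int m - 1" "k + int m"] by auto
    then have "x1 + N x2 \<in> M (k + int m)"
      using x1(1) by (intro subspace_add[OF SM])
    moreover have "x1 + N x2 \<in> W k"
      using x1(2) NW[OF x2(2)] by (intro subspace_add[OF SW])
    moreover have "(N ^^ m) w1 \<in> W (k - 1)" using NW x1(3) by (rule funpow_stable)
    then have "(d - (N ^^ Suc m) x2) + w + (N ^^ m) w1 \<in> W (k - 1)"
      using x2(3) d(3) by (intro subspace_add[OF SW])
    moreover have "(d - (N ^^ Suc m) x2) + w + (N ^^ m) w1 = y - (N ^^ m) (x1 + N x2)"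
    proof -
      have "(N ^^ Suc m) x2 = (N ^^ m) (N x2)"
        by (simp only: funpow_Suc_right o_apply)
      moreover have "y = d + w + ((N ^^ m) x1 + (N ^^ m) w1)"
        using d(4) unfolding x1(4) endo_add[OF endo_funpow[OF N]] diff_eq_eq .
      ultimately show ?thesis
        unfolding endo_add[OF endo_funpow[OF N]] by (simp del: funpow.simps)
    qed
    ultimately show ?case by metis
  qed
  moreover have "k - int m \<le> b + int (nat (k - int m - b))" by simp
  ultimately obtain x where "x \<in> M (k + int m)" "x \<in> W k" "y - (N ^^ m) x \<in> W (k - 1)"
    using assms(2,3) by metis
  then show thesis using that diff[OF assms(2)] by blast
qed

text \<open>Induction over the steps of \<open>W\<close>.  In \<open>W k\<close>, the steps of index at least \<open>k\<close> are compared by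
  descending induction, starting from the whole space; the steps below \<open>k\<close> are their images under
  powers of \<open>N\<close>, up to vectors of \<open>W (k - 1)\<close>.\<close>

lemma relative_weight_filtration_le:
  assumes M: "is_relative_weight_filtration U N W M"
    and M': "is_relative_weight_filtration U N W M'"
  shows "M c \<subseteq> M' c"
proof -
  note FW = relative_weight_filtrationD(1)[OF M] and FM = relative_weight_filtrationD(2)[OF M]
    and FM' = relative_weight_filtrationD(2)[OF M'] and N = relative_weight_filtrationD(3)[OF M]
    and NM = relative_weight_filtrationD(5)[OF M] and NM' = relative_weight_filtrationD(5)[OF M']
    and NW = relative_weight_filtrationD(4)[OF M]
  note SM' = is_filtrationD(1)[OF FM']
  obtain a where a: "\<And>k. k \<le> a \<Longrightarrow> W k = {0}" using is_filtrationD(4)[OF FW] by blast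
  obtain b where b: "\<And>k. k \<ge> b \<Longrightarrow> M' k = U" using is_filtrationD(5)[OF FM'] by blast
  have step: "M c \<inter> W k \<subseteq> M' c" if IH: "\<And>c. M c \<inter> W (k - 1) \<subseteq> M' c" for k c
  proof -
    have lower: "y \<in> M' (k - int m)"
      if y: "y \<in> M (k - int m)" "y \<in> W k" and up: "M (k + int m) \<inter> W k \<subseteq> M' (k + int m)" for m y
    proof -
      obtain x where x: "x \<in> M (k + int m)" "x \<in> W k"
        "y - (N ^^ m) x \<in> M (k - int m)" "y - (N ^^ m) x \<in> W (k - 1)"
        using relative_weight_filtration_surjectivity[OF M y] by blast
      have "(N ^^ m) x \<in> M' (k - int m)"
        by (rule funpow_shift[of M' N, OF NM', where k = "k + int m"]) (use up x in auto)
      moreover have "y - (N ^^ m) x \<in> M' (k - int m)" using IH x(3,4) by auto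
      ultimately have "(y - (N ^^ m) x) + (N ^^ m) x \<in> M' (k - int m)"
        by (intro subspace_add[OF SM'])
      then show ?thesis by simp
    qed
    have "M (k + int l) \<inter> W k \<subseteq> M' (k + int l)" if "k + int l \<ge> b - int n" for n l
      using that
    proof (induction n arbitrary: l)
      case 0
      then show ?case using b[of "k + int l"] is_filtrationD(3)[OF FM] by auto
    next
      case (Suc n)
      show ?case
      proof
        fix x assume x: "x \<in> M (k + int l) \<inter> W k"
        have "(N ^^ Suc l) x \<in> M (k - int (Suc (Suc l)))"
          by (rule funpow_shift[of M N, OF NM, where k = "k + int l"]) (use x in auto)
        moreover have "(N ^^ Suc l) x \<in> W k" using NW x by (intro funpow_stable) auto
        moreover have "M (k + int (Suc (Suc l))) \<inter> W k \<subseteq> M' (k + int (Suc (Suc l)))"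
          using Suc.prems by (intro Suc.IH) auto
        ultimately have "(N ^^ Suc l) x \<in> M' (k - int (Suc (Suc l)))"
          by (rule lower)
        then have "(N ^^ Suc l) x \<in> M' (k - int (Suc l) - 1)"
          by (simp add: algebra_simps)
        moreover have "x \<in> M' (k + int (Suc l))"
          using Suc.IH[of "Suc l"] Suc.prems x is_filtrationD(2)[OF FM, of "k + int l" "k + int (Suc l)"]
          by auto
        ultimately have "x \<in> M' (k + int (Suc l) - 1)"
          using x by (intro relative_weight_filtration_injectivity[OF M']) auto
        then show "x \<in> M' (k + int l)" by simp
      qed
    qed
    from this[of "nat (b - k)"] have upper: "M (k + int l) \<inter> W k \<subseteq> M' (k + int l)" for l
      by simp
    show ?thesis
    proof (cases "c \<ge> k")
      case True
      then show ?thesis using upper[of "nat (c - k)"] by simp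
    next
      case False
      then show ?thesis using lower[of _ "nat (k - c)"] upper[of "nat (k - c)"] by auto
    qed
  qed
  have "M c \<inter> W (a + int n) \<subseteq> M' c" for n c
  proof (induction n arbitrary: c)
    case 0
    show ?case using a[of a] subspace_0[OF SM'] by auto
  next
    case (Suc n)
    show ?case by (rule step) (use Suc in simp)
  qed
  note all = this
  obtain d where d: "\<And>k. k \<ge> d \<Longrightarrow> W k = U" using is_filtrationD(5)[OF FW] by blast
  have "W (a + int (nat (d - a))) = U" by (intro d) simp
  then show ?thesis using all[of c "nat (d - a)"] is_filtrationD(3)[OF FM, of c] by auto
qed

lemma relative_weight_filtration_eqI:
  assumes "is_relative_weight_filtration UNIV N W M"
  shows "relative_weight_filtration N W = M"
  unfolding relative_weight_filtration_def
proof (rule the_equality[of "is_relative_weight_filtration UNIV N W", OF assms])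
  fix M' assume M': "is_relative_weight_filtration UNIV N W M'"
  show "M' = M"
    using relative_weight_filtration_le[OF assms M'] relative_weight_filtration_le[OF M' assms] by blast
qed

text \<open>The bijectivity required of a relative weight filtration concerns only the maps which \<open>N\<close>
  induces on the quotients \<open>W k / W (k - 1)\<close>, and \<open>N\<close> and \<open>N'\<close> induce the same ones.\<close>

lemma relative_weight_filtration_transfer:
  assumes M: "is_relative_weight_filtration U N W M"
    and N': "endo N'" "nilpotent_on U N'" "\<And>k v. v \<in> W k \<Longrightarrow> N' v \<in> W k"
      "\<And>k v. v \<in> M k \<Longrightarrow> N' v \<in> M (k - 2)"
    and eq: "\<And>k v. v \<in> W k \<Longrightarrow> N' v - N v \<in> W (k - 1)"
  shows "is_relative_weight_filtration U N' W M"
proof -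
  note FW = relative_weight_filtrationD(1)[OF M] and FM = relative_weight_filtrationD(2)[OF M]
    and N = relative_weight_filtrationD(3)[OF M]
    and NW = relative_weight_filtrationD(4)[OF M] and NM = relative_weight_filtrationD(5)[OF M]
  note SW = is_filtrationD(1)[OF FW]
  have pow: "(N' ^^ l) v - (N ^^ l) v \<in> W (k - 1)" if v: "v \<in> W k" for l k v
  proof (induction l)
    case 0
    show ?case using subspace_0[OF SW] by simp
  next
    case (Suc l)
    have "N' ((N' ^^ l) v - (N ^^ l) v) \<in> W (k - 1)" by (rule N'(3)[OF Suc])
    moreover have "N' ((N ^^ l) v) - N ((N ^^ l) v) \<in> W (k - 1)"
      by (intro eq funpow_stable[of "W k"] NW v)
    ultimately have "N' ((N' ^^ l) v - (N ^^ l) v) + (N' ((N ^^ l) v) - N ((N ^^ l) v)) \<in> W (k - 1)"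
      by (rule subspace_add[OF SW])
    then show ?case by (simp add: endo_diff[OF N'(1)])
  qed
  have maps: "(N' ^^ l) ` induced_step M W k c \<subseteq> induced_step M W k (c - 2 * int l)" for k l c
  proof
    fix z assume "z \<in> (N' ^^ l) ` induced_step M W k c"
    then obtain x where x: "x \<in> induced_step M W k c" "z = (N' ^^ l) x" by auto
    obtain m w where m: "m \<in> M c" "m \<in> W k" "w \<in> W (k - 1)" "x = m + w"
      using x(1) by (rule induced_stepE)
    show "z \<in> induced_step M W k (c - 2 * int l)"
      unfolding x(2) m(4) endo_add[OF endo_funpow[OF N'(1)]]
      using m(1-3) by (intro induced_stepI funpow_shift[of M N', OF N'(4)] funpow_stable[of "W _"] N'(3)) auto
  qed
  have "induces_iso (N' ^^ l)
      (induced_step M W k (k + int l)) (induced_step M W k (k + int l - 1))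
      (induced_step M W k (k - int l)) (induced_step M W k (k - int l - 1))" for k l
  proof (rule induces_iso_cong[OF relative_weight_filtrationD(6)[OF M]])
    show "(N' ^^ l) ` induced_step M W k (k + int l) \<subseteq> induced_step M W k (k - int l)"
      using maps[of l k "k + int l"] by simp
    show "(N' ^^ l) ` induced_step M W k (k + int l - 1) \<subseteq> induced_step M W k (k - int l - 1)"
      using maps[of l k "k + int l - 1"] by (simp add: algebra_simps)
    show "(N' ^^ l) x - (N ^^ l) x \<in> induced_step M W k (k - int l - 1)"
      if "x \<in> induced_step M W k (k + int l)" for x
    proof -
      have "x \<in> W k"
        using that is_filtrationD(2)[OF FW, of "k - 1" k]
        by (auto elim!: induced_stepE intro!: subspace_add[OF SW])
      from pow[OF this] show ?thesis by (intro induced_stepI2[OF FM FW])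
    qed
  qed (intro endo_funpow N N'(1) subspace_induced_step[OF FW FM])+
  then show ?thesis
    unfolding is_relative_weight_filtration_def preserves_def
    using FW FM N' by blast
qed

section \<open>Degree-zero parts\<close>

text \<open>Since \<open>N\<close> preserves \<open>W\<close>, its components of positive degree vanish.  So \<open>N - N0\<close> is
  the sum of the components of negative degree, which lower \<open>W\<close>.\<close>

lemma degree_zero_partD:
  assumes gr: "is_grading W Y" and N: "\<And>k v. v \<in> W k \<Longrightarrow> N v \<in> W k"
    and N0: "is_degree_zero_part Y N N0"
  shows "endo N0" and "bracket Y N0 = (\<lambda>v. 0)"
    and "endo N" and "v \<in> W k \<Longrightarrow> N v - N0 v \<in> W (k - 1)"
proof -
  note Y = is_gradingD(1)[OF gr] and W = is_gradingD(4)[OF gr]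
  obtain C where C: "\<And>d. endo (C d)" "\<And>d. bracket Y (C d) = (\<lambda>v. scale (of_int d) (C d v))"
    "finite {d. C d \<noteq> (\<lambda>v. 0)}" "N = (\<lambda>v. \<Sum>d | C d \<noteq> (\<lambda>v. 0). C d v)" "C 0 = N0"
    using N0 unfolding is_degree_zero_part_def is_ad_decomposition_def by auto
  let ?D = "{d. C d \<noteq> (\<lambda>v. 0)}"
  show "endo N0" using C(1)[of 0] C(5) by simp
  show "bracket Y N0 = (\<lambda>v. 0)" using C(2)[of 0] C(5) by simp
  have endoN: "endo N" unfolding C(4) by (rule endo_sum_fun) (rule C(1))
  then show "endo N" .
  have eigen: "N x - N0 x \<in> W (j - 1)" if x: "x \<in> eigenspace Y j" for x j
  proof -
    have Cx: "C d x \<in> eigenspace Y (j + d)" for d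
      by (rule ad_eigenvector_maps_eigenspace[OF C(1) C(2) x])
    have Nx: "(\<Sum>d\<in>?D. C d x) \<in> W j"
      using N[OF eigenspace_subset_filtration[OF gr x order_refl]] unfolding C(4) .
    have "C d x \<in> W (j - 1)" if d: "d \<in> ?D" "d \<noteq> 0" for d
    proof (cases "d < 0")
      case True
      then show ?thesis by (intro eigenspace_subset_filtration[OF gr Cx]) simp
    next
      case False
      have "C d x \<in> W j"
        using eigencomponents_in_stable_subspace[OF Y W grading_preserves[OF gr] C(3),
            of j "\<lambda>d. j + d" "\<lambda>d. C d x" d] Cx Nx d(1) by auto
      then have "C d x = 0"
        by (rule eigenspace_inter_filtration[OF gr Cx]) (use False d(2) in simp)
      then show ?thesis by (simp add: subspace_0[OF W])
    qed
    then have "(\<Sum>d\<in>?D - {0}. C d x) \<in> W (j - 1)"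
      by (intro subspace_sum[OF W]) auto
    also have "(\<Sum>d\<in>?D - {0}. C d x) = (\<Sum>d\<in>?D. C d x) - C 0 x"
      by (cases "0 \<in> ?D") (simp_all add: sum_diff1 C(3))
    finally show ?thesis unfolding C(5) unfolding C(4) .
  qed
  show "N v - N0 v \<in> W (k - 1)" if v: "v \<in> W k" for v k
  proof (rule image_span_subset[where A = "\<Union>j\<in>{..k}. eigenspace Y j" and f = "\<lambda>v. N v - N0 v"])
    show "endo (\<lambda>v. N v - N0 v)" by (intro endo_minus_fun endoN \<open>endo N0\<close>)
    show "subspace (W (k - 1))" by (rule W)
    show "v \<in> span (\<Union>j\<in>{..k}. eigenspace Y j)" using v is_gradingD(3)[OF gr] by simp
    fix x assume "x \<in> (\<Union>j\<in>{..k}. eigenspace Y j)"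
    then obtain j where j: "j \<le> k" "x \<in> eigenspace Y j" by auto
    have "W (j - 1) \<subseteq> W (k - 1)"
      unfolding is_gradingD(3)[OF gr] using j(1) by (intro span_mono UN_mono) auto
    then show "N x - N0 x \<in> W (k - 1)" using eigen[OF j(2)] by blast
  qed
qed

lemma endo_eqI_eigenspaces:
  assumes "span (\<Union>j. eigenspace Y j) = UNIV" "endo f" "endo g"
    and "\<And>j x. x \<in> eigenspace Y j \<Longrightarrow> f x = g x"
  shows "f = g"
proof
  fix v
  have "f v - g v \<in> {0}"
    by (rule image_span_subset[where A = "\<Union>j. eigenspace Y j" and f = "\<lambda>v. f v - g v"])
      (use assms in \<open>auto intro: endo_minus_fun\<close>)
  then show "f v = g v" by simp
qed

lemma degree_zero_part_unique:
  assumes gr: "is_grading W Y" and N: "\<And>k v. v \<in> W k \<Longrightarrow> N v \<in> W k"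
    and "is_degree_zero_part Y N N0" "is_degree_zero_part Y N N1"
  shows "N0 = N1"
proof (rule endo_eqI_eigenspaces[OF is_gradingD(2)[OF gr]])
  note D0 = degree_zero_partD[OF gr N assms(3)] and D1 = degree_zero_partD[OF gr N assms(4)]
  show "endo N0" by (rule D0(1))
  show "endo N1" by (rule D1(1))
  fix j x assume x: "x \<in> eigenspace Y j"
  have "N0 x - N1 x \<in> eigenspace Y j"
    by (intro subspace_diff subspace_eigenspace is_gradingD(1)[OF gr]
        commuting_maps_eigenspace[OF D0(1,2) x] commuting_maps_eigenspace[OF D1(1,2) x])
  moreover have xW: "x \<in> W j" by (rule eigenspace_subset_filtration[OF gr x]) simp
  have "(N x - N1 x) - (N x - N0 x) \<in> W (j - 1)"
    by (intro subspace_diff[OF is_gradingD(4)[OF gr]] D0(4) D1(4) xW)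
  then have "N0 x - N1 x \<in> W (j - 1)" by simp
  ultimately have "N0 x - N1 x = 0"
    by (rule eigenspace_inter_filtration[OF gr]) simp
  then show "N0 x = N1 x" by simp
qed

text \<open>The component of degree \<open>d\<close> of an endomorphism \<open>D\<close> is the sum of the operators
  \<open>\<pi> (k + d) \<circ> D \<circ> \<pi> k\<close>.  For \<open>D = N - N0\<close> the component of degree \<open>0\<close> vanishes, because \<open>D\<close>
  lowers \<open>W\<close>.\<close>

lemma degree_zero_partI:
  assumes W: "is_filtration UNIV W" and gr: "is_grading W Y" and N: "endo N"
    and N0: "endo N0" "bracket Y N0 = (\<lambda>v. 0)"
    and lower: "\<And>k v. v \<in> W k \<Longrightarrow> N v - N0 v \<in> W (k - 1)"
  shows "is_degree_zero_part Y N N0"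
proof -
  note Y = is_gradingD(1)[OF gr]
  obtain \<pi> J where J: "finite J" and endo\<pi>: "\<And>j. endo (\<pi> j)" and \<pi>: "\<And>j v. \<pi> j v \<in> eigenspace Y j"
    "\<And>j v. j \<notin> J \<Longrightarrow> \<pi> j v = 0" and sum\<pi>: "\<And>v. v = (\<Sum>j\<in>J. \<pi> j v)"
    and \<pi>_eigen: "\<And>i j v. v \<in> eigenspace Y i \<Longrightarrow> \<pi> j v = (if i = j then v else 0)"
    by (rule grading_projections[OF W gr]) (rule that; assumption)
  define D where "D v = N v - N0 v" for v
  have D: "endo D" unfolding D_def by (intro endo_minus_fun N N0)
  define C where "C d v = (\<Sum>k\<in>J. \<pi> (k + d) (D (\<pi> k v))) + (if d = 0 then N0 v else 0)" for d v
  have \<pi>Y: "\<pi> k (Y v) = scale (of_int k) (\<pi> k v)" for k v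
  proof -
    have "\<pi> k (Y v) = (\<Sum>j\<in>J. \<pi> k (Y (\<pi> j v)))"
      by (subst sum\<pi>[of v]) (simp only: endo_sum[OF Y] endo_sum[OF endo\<pi>])
    also have "\<dots> = (\<Sum>j\<in>J. if k = j then scale (of_int k) (\<pi> k v) else 0)"
      by (intro sum.cong) (auto simp: eigenspaceD[OF \<pi>(1)] endo_scale[OF endo\<pi>] \<pi>_eigen[OF \<pi>(1)])
    also have "\<dots> = scale (of_int k) (\<pi> k v)"
      using J \<pi>(2)[of k v] by auto
    finally show ?thesis .
  qed
  have zero_below: "\<pi> k u = 0" if u: "u \<in> W (k - 1)" for k u
  proof -
    have "\<pi> k u \<in> {0}"
    proof (rule image_span_subset[where A = "\<Union>j\<in>{..k - 1}. eigenspace Y j" and f = "\<pi> k"])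
      show "u \<in> span (\<Union>j\<in>{..k - 1}. eigenspace Y j)" using u is_gradingD(3)[OF gr] by simp
    qed (auto simp: endo\<pi> \<pi>_eigen)
    then show ?thesis by simp
  qed
  have "\<pi> k (D (\<pi> k v)) = 0" for k v
    unfolding D_def by (intro zero_below lower eigenspace_subset_filtration[OF gr \<pi>(1)]) simp
  then have C0: "C 0 = N0" by (simp add: C_def fun_eq_iff)
  have endoC: "endo (C d)" for d
  proof -
    have "endo (\<lambda>v. \<pi> (k + d) (D (\<pi> k v)))" for k
      by (rule endo_comp[OF endo\<pi> endo_comp[OF D endo\<pi>]])
    moreover have "endo (\<lambda>v. if d = 0 then N0 v else 0)"
      by (cases "d = 0") (simp_all add: N0 endo_const_zero)
    ultimately show ?thesis
      unfolding C_def by (rule endo_plus_fun[OF endo_sum_fun])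
  qed
  have adC: "bracket Y (C d) = (\<lambda>v. scale (of_int d) (C d v))" for d
  proof
    fix v
    show "bracket Y (C d) v = scale (of_int d) (C d v)"
    proof (cases "d = 0")
      case True
      then show ?thesis using C0 N0(2) by simp
    next
      case False
      then have "bracket Y (C d) v = (\<Sum>k\<in>J. Y (\<pi> (k + d) (D (\<pi> k v))) - \<pi> (k + d) (D (\<pi> k (Y v))))"
        by (simp add: bracket_def C_def endo_sum[OF Y] sum_subtractf)
      also have "\<dots> = (\<Sum>k\<in>J. scale (of_int d) (\<pi> (k + d) (D (\<pi> k v))))"
        by (intro sum.cong refl)
          (simp add: eigenspaceD[OF \<pi>(1)] \<pi>Y endo_scale[OF D] endo_scale[OF endo\<pi>] scale_left_distrib)
      finally show ?thesis using False by (simp add: C_def scale_sum_right)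
    qed
  qed
  \<comment> \<open>Only differences of two eigenvalues of \<open>Y\<close> can occur as degrees.\<close>
  define T where "T = insert 0 ((\<lambda>(i, j). j - i) ` (J \<times> J))"
  have T: "finite T" using J by (simp add: T_def)
  have supp: "C d = (\<lambda>v. 0)" if d: "d \<notin> T" for d
  proof -
    have "k + d \<notin> J" if "k \<in> J" for k
    proof
      assume "k + d \<in> J"
      then have "(k + d) - k \<in> T" using that unfolding T_def by (intro insertI2 rev_image_eqI[of "(k, k + d)"]) auto
      then show False using d by simp
    qed
    moreover have "d \<noteq> 0" using d by (auto simp: T_def)
    ultimately show ?thesis using \<pi>(2) by (simp add: C_def fun_eq_iff)
  qed
  have supp': "{d. C d \<noteq> (\<lambda>v. 0)} \<subseteq> T" using supp by blast
  have "N v = (\<Sum>d | C d \<noteq> (\<lambda>v. 0). C d v)" for v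
  proof -
    have inner: "(\<Sum>d\<in>T. \<pi> (k + d) u) = u" if k: "k \<in> J" for k u
    proof -
      have "(\<Sum>d\<in>T. \<pi> (k + d) u) = (\<Sum>j\<in>(+) k ` T. \<pi> j u)"
        by (subst sum.reindex) auto
      also have "\<dots> = (\<Sum>j\<in>J. \<pi> j u)"
      proof (intro sum.mono_neutral_right)
        show "J \<subseteq> (+) k ` T"
        proof
          fix j assume "j \<in> J"
          then have "j - k \<in> T" using k unfolding T_def by (intro insertI2 rev_image_eqI[of "(k, j)"]) auto
          then show "j \<in> (+) k ` T" by (intro rev_image_eqI[of "j - k"]) auto
        qed
      qed (use T \<pi>(2) in auto)
      finally show ?thesis using sum\<pi>[of u] by simp
    qed
    have "(\<Sum>d | C d \<noteq> (\<lambda>v. 0). C d v) = (\<Sum>d\<in>T. C d v)"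
      using T supp' by (intro sum.mono_neutral_left) auto
    also have "\<dots> = (\<Sum>k\<in>J. \<Sum>d\<in>T. \<pi> (k + d) (D (\<pi> k v))) + (\<Sum>d\<in>T. if d = 0 then N0 v else 0)"
      unfolding C_def sum.distrib by (subst sum.swap) (rule refl)
    also have "\<dots> = (\<Sum>k\<in>J. D (\<pi> k v)) + N0 v"
      using T by (simp add: inner) (simp add: T_def)
    also have "(\<Sum>k\<in>J. D (\<pi> k v)) = D v"
      by (subst (2) sum\<pi>[of v]) (simp only: endo_sum[OF D])
    finally show ?thesis by (simp add: D_def)
  qed
  then have "is_ad_decomposition Y N C"
    unfolding is_ad_decomposition_def using endoC adC finite_subset[OF supp' T] by blast
  then show ?thesis unfolding is_degree_zero_part_def using C0 by blast
qed

section \<open>Commuting gradings\<close>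

text \<open>Since \<open>Y'\<close> preserves the eigenspaces of \<open>Y\<close>, these are spanned by simultaneous eigenvectors,
  on which \<open>Y - Y'\<close> acts by the difference of the two eigenvalues.\<close>

lemma commuting_gradings_common_eigenvectors:
  assumes gr: "is_grading W Y" and gr': "is_grading W' Y'" and comm: "bracket Y Y' = (\<lambda>v. 0)"
    and x: "x \<in> eigenspace Y i"
  shows "x \<in> span (\<Union>j. eigenspace Y' j \<inter> eigenspace Y i)"
proof (rule stable_subspace_spanned_by_eigenvectors[OF is_gradingD(1,2)[OF gr'] _ _ x])
  show "subspace (eigenspace Y i)" by (rule subspace_eigenspace[OF is_gradingD(1)[OF gr]])
  show "Y' v \<in> eigenspace Y i" if "v \<in> eigenspace Y i" for v
    by (rule commuting_maps_eigenspace[OF is_gradingD(1)[OF gr'] comm that])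
qed

lemma eigenspace_difference:
  "v \<in> eigenspace Y i \<Longrightarrow> v \<in> eigenspace Y' j \<Longrightarrow> v \<in> eigenspace (\<lambda>v. Y v - Y' v) (i - j)"
  by (simp add: eigenspace_def scale_left_diff_distrib)

lemma difference_of_commuting_gradings_diagonalizable:
  assumes gr: "is_grading W Y" and gr': "is_grading W' Y'" and comm: "bracket Y Y' = (\<lambda>v. 0)"
  shows "span (\<Union>b. eigenspace (\<lambda>v. Y v - Y' v) b) = UNIV"
proof -
  let ?S = "span (\<Union>b. eigenspace (\<lambda>v. Y v - Y' v) b)"
  have "eigenspace Y i \<subseteq> ?S" for i
  proof
    fix x assume "x \<in> eigenspace Y i"
    then have "x \<in> span (\<Union>j. eigenspace Y' j \<inter> eigenspace Y i)"
      by (rule commuting_gradings_common_eigenvectors[OF gr gr' comm])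
    also have "\<dots> \<subseteq> ?S"
      by (intro span_mono) (use eigenspace_difference in blast)
    finally show "x \<in> ?S" .
  qed
  then have "span (\<Union>i. eigenspace Y i) \<subseteq> ?S"
    by (intro span_minimal) auto
  then show ?thesis using is_gradingD(2)[OF gr] by auto
qed

text \<open>With \<open>H = Y - Y'\<close>, both sides are spanned by simultaneous eigenvectors of \<open>Y'\<close> and \<open>H\<close>.  The
  point of the formula is that its right-hand side contains \<open>W\<close> and \<open>H\<close>, but not the choice of the
  grading \<open>Y'\<close> of \<open>W\<close>.\<close>

lemma filtration_from_commuting_grading:
  assumes gr: "is_grading M Y" and gr': "is_grading W Y'" and comm: "bracket Y Y' = (\<lambda>v. 0)"
  shows "M k = span (\<Union>(a, b)\<in>{(a, b). a + b \<le> k}. W a \<inter> eigenspace (\<lambda>v. Y v - Y' v) b)"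
proof
  let ?H = "\<lambda>v. Y v - Y' v"
  let ?S = "span (\<Union>(a, b)\<in>{(a, b). a + b \<le> k}. W a \<inter> eigenspace ?H b)"
  note Y = is_gradingD(1)[OF gr] and Y' = is_gradingD(1)[OF gr']
  have comm': "Y (Y' v) = Y' (Y v)" for v using comm by (simp add: bracket_zero_iff)
  have "eigenspace Y i \<subseteq> ?S" if i: "i \<le> k" for i
  proof
    fix x assume "x \<in> eigenspace Y i"
    then have "x \<in> span (\<Union>j. eigenspace Y' j \<inter> eigenspace Y i)"
      by (rule commuting_gradings_common_eigenvectors[OF gr gr' comm])
    also have "\<dots> \<subseteq> ?S"
    proof (intro span_mono subsetI)
      fix y assume "y \<in> (\<Union>j. eigenspace Y' j \<inter> eigenspace Y i)"
      then obtain j where "y \<in> eigenspace Y' j" "y \<in> eigenspace Y i" by blast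
      then have "y \<in> W j \<inter> eigenspace ?H (i - j)"
        using eigenspace_subset_filtration[OF gr', of y j j] eigenspace_difference[of y Y i Y' j] by simp
      then show "y \<in> (\<Union>(a, b)\<in>{(a, b). a + b \<le> k}. W a \<inter> eigenspace ?H b)"
        using i by (intro UN_I[of "(j, i - j)"]) auto
    qed
    finally show "x \<in> ?S" .
  qed
  then show "M k \<subseteq> ?S"
    unfolding is_gradingD(3)[OF gr] by (intro span_minimal) auto
  have "W a \<inter> eigenspace ?H b \<subseteq> M k" if ab: "a + b \<le> k" for a b
  proof
    fix x assume x: "x \<in> W a \<inter> eigenspace ?H b"
    let ?U = "W a \<inter> eigenspace ?H b"
    have "x \<in> span (\<Union>j. eigenspace Y' j \<inter> ?U)"
    proof (rule stable_subspace_spanned_by_eigenvectors[OF is_gradingD(1,2)[OF gr'] _ _ x])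
      show "subspace ?U"
        by (intro subspace_inter subspace_eigenspace endo_minus_fun Y Y' is_gradingD(4)[OF gr'])
      show "Y' v \<in> ?U" if v: "v \<in> ?U" for v
      proof
        show "Y' v \<in> W a" using grading_preserves[OF gr'] v by simp
        show "Y' v \<in> eigenspace ?H b"
        proof (rule commuting_maps_eigenspace[OF Y'])
          show "bracket ?H Y' = (\<lambda>v. 0)"
            by (simp add: bracket_zero_iff endo_diff[OF Y'] comm')
        qed (use v in simp)
      qed
    qed
    also have "\<dots> \<subseteq> M k"
    proof (rule span_minimal[OF _ is_gradingD(4)[OF gr]], rule subsetI)
      fix y assume "y \<in> (\<Union>j. eigenspace Y' j \<inter> ?U)"
      then obtain j where y: "y \<in> eigenspace Y' j" "y \<in> W a" "y \<in> eigenspace ?H b" by blast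
      show "y \<in> M k"
      proof (cases "a < j")
        case True
        then have "y = 0" using eigenspace_inter_filtration[OF gr' y(1,2)] by simp
        then show ?thesis using subspace_0[OF is_gradingD(4)[OF gr]] by simp
      next
        case False
        have "Y y = scale (of_int (j + b)) y"
          using y(1) y(3) by (simp add: eigenspace_def scale_left_distrib algebra_simps)
        then have "y \<in> eigenspace Y (j + b)" by (rule eigenspaceI)
        then show ?thesis
          by (rule eigenspace_subset_filtration[OF gr]) (use False ab in simp)
      qed
    qed
    finally show "x \<in> M k" .
  qed
  then show "?S \<subseteq> M k"
    by (intro span_minimal is_gradingD(4)[OF gr]) auto
qed

section \<open>Gradings and filtrations attached to a system\<close>

lemma deligne_systemD:
  assumes "deligne_system r W N Y"
  shows "is_filtration UNIV W"
    and "j \<in> {1..r} \<Longrightarrow> endo (N j)"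
    and "i \<in> {1..r} \<Longrightarrow> j \<in> {1..r} \<Longrightarrow> bracket (N i) (N j) = (\<lambda>v. 0)"
    and "j \<in> {1..r} \<Longrightarrow>
      is_relative_weight_filtration UNIV (N j) (weight_seq W N (j - 1)) (weight_seq W N j)"
    and "j \<in> {1..r} \<Longrightarrow> k + 1 < j \<Longrightarrow> is_relative_weight_filtration (weight_seq W N k l) (N j)
          (\<lambda>i. weight_seq W N (j - 1) i \<inter> weight_seq W N k l)
          (\<lambda>i. weight_seq W N j i \<inter> weight_seq W N k l)"
    and "j \<in> {1..r} \<Longrightarrow> k \<in> {0..r} \<Longrightarrow> v \<in> weight_seq W N k l \<Longrightarrow> N j v \<in> weight_seq W N k l"
    and "j \<in> {1..r} \<Longrightarrow> k \<in> {j..r} \<Longrightarrow> v \<in> weight_seq W N k l \<Longrightarrow> N j v \<in> weight_seq W N k (l - 2)"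
    and "is_grading (weight_seq W N r) Y"
    and "j \<in> {0..r} \<Longrightarrow> v \<in> weight_seq W N j l \<Longrightarrow> Y v \<in> weight_seq W N j l"
    and "j \<in> {1..r} \<Longrightarrow> bracket Y (N j) = (\<lambda>v. scale (- 2) (N j v))"
  using assms unfolding deligne_system_def
  by (simp_all add: preserves_def image_subset_iff)

lemma is_filtration_weight_seq:
  assumes "deligne_system r W N Y" "j \<le> r"
  shows "is_filtration UNIV (weight_seq W N j)"
proof (cases "j = 0")
  case True
  then show ?thesis using deligne_systemD(1)[OF assms(1)] by simp
next
  case False
  then have "j \<in> {1..r}" using assms(2) by simp
  from relative_weight_filtrationD(2)[OF deligne_systemD(4)[OF assms(1) this]] show ?thesis .
qed

text \<open>The grading \<open>Y\<^sup>j\<close>, recovered from \<open>Y = Y\<^sup>r\<close> and the \<open>H i = Y\<^sup>i - Y\<^sup>i\<^sup>-\<^sup>1\<close>.\<close>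

definition partial_grading ::
    "nat \<Rightarrow> (nat \<Rightarrow> 'b \<Rightarrow> 'b) \<Rightarrow> ('b \<Rightarrow> 'b) \<Rightarrow> nat \<Rightarrow> 'b \<Rightarrow> 'b" where
  "partial_grading r H Y j = (\<lambda>v. Y v - (\<Sum>i\<in>{j<..r}. H i v))"

lemma partial_grading_top: "partial_grading r H Y r = Y"
  by (simp add: partial_grading_def)

lemma partial_grading_pred:
  assumes "j \<in> {1..r}"
  shows "partial_grading r H Y (j - 1) v = partial_grading r H Y j v - H j v"
proof -
  have "{j - 1<..r} = insert j {j<..r}" using assms by auto
  then show ?thesis by (simp add: partial_grading_def algebra_simps)
qed

lemma endo_partial_grading:
  "endo Y \<Longrightarrow> (\<And>j. j \<in> {1..r} \<Longrightarrow> endo (H j)) \<Longrightarrow> endo (partial_grading r H Y j)"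
  unfolding partial_grading_def by (intro endo_minus_fun endo_sum_fun) auto

text \<open>The operator \<open>N0\<close> of Deligne's construction coincides with \<open>Nhat j\<close> by the uniqueness of
  degree-zero parts, so that the commutation property of \<open>Y\<^sup>j\<^sup>-\<^sup>1\<close> becomes one of \<open>N j - Nhat j\<close>.\<close>

lemma has_sl2_typeD:
  assumes D: "deligne_system r W N Y" and ty: "has_sl2_type r W N Y Nhat H"
  shows "j \<le> r \<Longrightarrow> is_grading (weight_seq W N j) (partial_grading r H Y j)"
    and "j \<in> {1..r} \<Longrightarrow> bracket (partial_grading r H Y j) (partial_grading r H Y (j - 1)) = (\<lambda>v. 0)"
    and "j \<in> {1..r} \<Longrightarrow> is_degree_zero_part (partial_grading r H Y (j - 1)) (N j) (Nhat j)"
    and "j \<in> {1..r} \<Longrightarrow> \<exists>P. sl2_triple P (H j) (Nhat j) \<and> bracket (\<lambda>v. N j v - Nhat j v) P = (\<lambda>v. 0)"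
proof -
  obtain Ys where Ysr: "Ys r = Y"
    and dg: "\<And>j. j \<in> {1..r} \<Longrightarrow> is_deligne_grading (weight_seq W N (j - 1)) (N j) (Ys j) (Ys (j - 1))"
    and dz: "\<And>j. j \<in> {1..r} \<Longrightarrow> is_degree_zero_part (Ys (j - 1)) (N j) (Nhat j)"
    and H: "\<And>j. j \<in> {1..r} \<Longrightarrow> H j = (\<lambda>v. Ys j v - Ys (j - 1) v)"
    using ty unfolding has_sl2_type_def by auto
  have Ys: "partial_grading r H Y j = Ys j" if "j \<le> r" for j
    using that
  proof (induction j rule: inc_induct)
    case base
    show ?case by (simp add: Ysr partial_grading_top)
  next
    case (step j)
    then have "partial_grading r H Y j v = Ys j v" for v
      using partial_grading_pred[of "Suc j" r H Y v] by (simp add: H)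
    then show ?case by (rule ext)
  qed
  show gr: "is_grading (weight_seq W N j) (partial_grading r H Y j)" if "j \<le> r" for j
  proof (cases "j = r")
    case True
    then show ?thesis using deligne_systemD(8)[OF D] by (simp add: partial_grading_top)
  next
    case False
    then have "Suc j \<in> {1..r}" using that by simp
    from dg[OF this] show ?thesis using that by (simp add: is_deligne_grading_def Ys)
  qed
  show "bracket (partial_grading r H Y j) (partial_grading r H Y (j - 1)) = (\<lambda>v. 0)" if "j \<in> {1..r}"
    using dg[OF that] that Ys[of j] Ys[of "j - 1"] by (auto simp: is_deligne_grading_def)
  have le: "j - 1 \<le> r" if "j \<in> {1..r}" for j using that by auto
  show dz': "is_degree_zero_part (partial_grading r H Y (j - 1)) (N j) (Nhat j)" if "j \<in> {1..r}" for j
    using dz[OF that] Ys[OF le[OF that]] by simp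
  show "\<exists>P. sl2_triple P (H j) (Nhat j) \<and> bracket (\<lambda>v. N j v - Nhat j v) P = (\<lambda>v. 0)"
    if j: "j \<in> {1..r}"
  proof -
    obtain N0 P where N0: "is_degree_zero_part (Ys (j - 1)) (N j) N0"
      "sl2_triple P (\<lambda>v. Ys j v - Ys (j - 1) v) N0" "bracket (\<lambda>v. N j v - N0 v) P = (\<lambda>v. 0)"
      using dg[OF j] unfolding is_deligne_grading_def by blast
    have "N0 = Nhat j"
    proof (rule degree_zero_part_unique[OF gr[OF le[OF j]]])
      show "N j v \<in> weight_seq W N (j - 1) k" if "v \<in> weight_seq W N (j - 1) k" for k v
        by (rule deligne_systemD(6)[OF D j _ that]) (use j in auto)
      show "is_degree_zero_part (partial_grading r H Y (j - 1)) (N j) N0"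
        using N0(1) Ys[OF le[OF j]] by simp
      show "is_degree_zero_part (partial_grading r H Y (j - 1)) (N j) (Nhat j)" by (rule dz'[OF j])
    qed
    then show ?thesis using N0(2,3) H[OF j] by auto
  qed
qed

text \<open>As \<open>Y\<^sup>j\<close> and \<open>Y\<^sup>j\<^sup>-\<^sup>1\<close> are commuting gradings with difference \<open>H j\<close>, the filtration \<open>W\<^sup>j\<close> is determined
  by \<open>W\<^sup>j\<^sup>-\<^sup>1\<close> and the eigenspaces of \<open>H j\<close>.\<close>

lemma weight_seq_determined_by_type:
  assumes "deligne_system r W N Y" "has_sl2_type r W N Y Nhat H"
    and "deligne_system r W N' Y'" "has_sl2_type r W N' Y' Nhat H"
  shows "j \<le> r \<Longrightarrow> weight_seq W N j = weight_seq W N' j"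
proof (induction j)
  case 0
  show ?case by simp
next
  case (Suc j)
  note type = has_sl2_typeD[OF assms(1,2)] and type' = has_sl2_typeD[OF assms(3,4)]
  have j: "Suc j \<in> {1..r}" "Suc j \<le> r" "j \<le> r" using Suc.prems by auto
  have H: "(\<lambda>v. partial_grading r H Y (Suc j) v - partial_grading r H Y j v) = H (Suc j)" for Y
    using partial_grading_pred[OF j(1)] by (simp add: fun_eq_iff)
  show ?case
  proof
    fix k
    show "weight_seq W N (Suc j) k = weight_seq W N' (Suc j) k"
      using filtration_from_commuting_grading[OF type(1)[OF j(2)] type(1)[OF j(3)], of k]
        filtration_from_commuting_grading[OF type'(1)[OF j(2)] type'(1)[OF j(3)], of k]
        type(2)[OF j(1)] type'(2)[OF j(1)] Suc.IH[OF j(3)]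
      by (simp add: H del: weight_seq.simps)
  qed
qed

section \<open>Equations for the systems of a given type\<close>

text \<open>Here \<open>M j\<close> stands for the filtration \<open>W\<^sup>j\<close>, and \<open>P j\<close> for the operator which completes
  \<open>Nhat j\<close> and \<open>H j\<close> to an \<open>sl\<^sub>2\<close>-triple.  All of these are determined by the type, so that the clauses
  are equations of degree at most two for the matrix entries of \<open>N\<close> and \<open>Y\<close>.  The first clause says
  that \<open>Y\<^sup>j\<close> is a grading of \<open>W\<^sup>j\<close>; the eighth and ninth say that \<open>Nhat j\<close> is the degree-zero part
  of \<open>N j\<close>.\<close>

definition type_equations ::
    "nat \<Rightarrow> (nat \<Rightarrow> int \<Rightarrow> 'b set) \<Rightarrow> (nat \<Rightarrow> 'b \<Rightarrow> 'b) \<Rightarrow> (nat \<Rightarrow> 'b \<Rightarrow> 'b) \<Rightarrow> (nat \<Rightarrow> 'b \<Rightarrow> 'b) \<Rightarrow>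
      (nat \<Rightarrow> 'b \<Rightarrow> 'b) \<Rightarrow> ('b \<Rightarrow> 'b) \<Rightarrow> bool" where
  "type_equations r M Nhat H P N Y \<longleftrightarrow>
     (\<forall>j\<in>{0..r}. \<forall>k. \<forall>v\<in>M j k. partial_grading r H Y j v - scale (of_int k) v \<in> M j (k - 1)) \<and>
     (\<forall>j\<in>{1..r}. bracket (partial_grading r H Y j) (partial_grading r H Y (j - 1)) = (\<lambda>v. 0)) \<and>
     (\<forall>j\<in>{0..r}. \<forall>k. \<forall>v\<in>M j k. Y v \<in> M j k) \<and>
     (\<forall>i\<in>{1..r}. \<forall>j\<in>{1..r}. bracket (N i) (N j) = (\<lambda>v. 0)) \<and>
     (\<forall>j\<in>{1..r}. \<forall>k\<in>{0..r}. \<forall>l. \<forall>v\<in>M k l. N j v \<in> M k l) \<and>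
     (\<forall>j\<in>{1..r}. \<forall>k\<in>{j..r}. \<forall>l. \<forall>v\<in>M k l. N j v \<in> M k (l - 2)) \<and>
     (\<forall>j\<in>{1..r}. (\<lambda>v. bracket Y (N j) v - scale (- 2) (N j v)) = (\<lambda>v. 0)) \<and>
     (\<forall>j\<in>{1..r}. \<forall>k. \<forall>v\<in>M (j - 1) k. N j v - Nhat j v \<in> M (j - 1) (k - 1)) \<and>
     (\<forall>j\<in>{1..r}. bracket (partial_grading r H Y (j - 1)) (Nhat j) = (\<lambda>v. 0)) \<and>
     (\<forall>j\<in>{1..r}. bracket (\<lambda>v. N j v - Nhat j v) (P j) = (\<lambda>v. 0))"

lemma type_equationsD:
  assumes "type_equations r M Nhat H P N Y"
  shows "j \<le> r \<Longrightarrow> v \<in> M j k \<Longrightarrow> partial_grading r H Y j v - scale (of_int k) v \<in> M j (k - 1)"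
    and "j \<in> {1..r} \<Longrightarrow> bracket (partial_grading r H Y j) (partial_grading r H Y (j - 1)) = (\<lambda>v. 0)"
    and "j \<le> r \<Longrightarrow> v \<in> M j k \<Longrightarrow> Y v \<in> M j k"
    and "i \<in> {1..r} \<Longrightarrow> j \<in> {1..r} \<Longrightarrow> bracket (N i) (N j) = (\<lambda>v. 0)"
    and "j \<in> {1..r} \<Longrightarrow> i \<le> r \<Longrightarrow> v \<in> M i k \<Longrightarrow> N j v \<in> M i k"
    and "j \<in> {1..r} \<Longrightarrow> i \<in> {j..r} \<Longrightarrow> v \<in> M i k \<Longrightarrow> N j v \<in> M i (k - 2)"
    and "j \<in> {1..r} \<Longrightarrow> bracket Y (N j) = (\<lambda>v. scale (- 2) (N j v))"
    and "j \<in> {1..r} \<Longrightarrow> v \<in> M (j - 1) k \<Longrightarrow> N j v - Nhat j v \<in> M (j - 1) (k - 1)"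
    and "j \<in> {1..r} \<Longrightarrow> bracket (partial_grading r H Y (j - 1)) (Nhat j) = (\<lambda>v. 0)"
    and "j \<in> {1..r} \<Longrightarrow> bracket (\<lambda>v. N j v - Nhat j v) (P j) = (\<lambda>v. 0)"
  using assms unfolding type_equations_def fun_eq_iff
  by (simp_all add: eq_neg_iff_add_eq_0)

text \<open>A solution \<open>(N, Y)\<close> of the equations inherits the relative weight filtrations
  from any system \<open>(N', Y')\<close> of the given type, because \<open>N j\<close> and \<open>N' j\<close> both agree with \<open>Nhat j\<close>
  modulo operators which lower \<open>W\<^sup>j\<^sup>-\<^sup>1\<close>.\<close>

lemma type_equations_sufficient:
  assumes D': "deligne_system r W N' Y'" and eqs': "type_equations r (weight_seq W N') Nhat H P N' Y'"
    and eqs: "type_equations r (weight_seq W N') Nhat H P N Y"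
    and sl2: "\<And>j. j \<in> {1..r} \<Longrightarrow> sl2_triple (P j) (H j) (Nhat j)"
    and N: "\<And>j. j \<in> {1..r} \<Longrightarrow> endo (N j)" and Y: "endo Y"
  shows "deligne_system r W N Y \<and> has_sl2_type r W N Y Nhat H"
proof -
  let ?M = "weight_seq W N'"
  let ?G = "partial_grading r H Y"
  note E = type_equationsD[OF eqs]
  note F = is_filtration_weight_seq[OF D']
  note S = is_filtrationD(1)[OF F]
  have H: "endo (H j)" and Nhat: "endo (Nhat j)" if "j \<in> {1..r}" for j
    using sl2[OF that] by (auto simp: sl2_triple_def)
  have le: "j - 1 \<le> r" "j \<le> r" if "j \<in> {1..r}" for j using that by auto
  have endoG: "endo (?G j)" for j by (intro endo_partial_grading Y H)
  have gr: "is_grading (?M j) (?G j)" if "j \<le> r" for j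
    by (rule is_gradingI[OF F[OF that] endoG]) (rule E(1)[OF that])
  \<comment> \<open>\<open>N j\<close> lowers the index of \<open>W\<^sup>j\<close> by two, and \<open>W\<^sup>j\<close> has finitely many steps.\<close>
  have nilp: "nilpotent_on UNIV (N j)" if j: "j \<in> {1..r}" for j
  proof -
    obtain a b where a: "\<And>k. k \<le> a \<Longrightarrow> ?M j k = {0}" and b: "\<And>k. k \<ge> b \<Longrightarrow> ?M j k = UNIV"
      using is_filtrationD(4,5)[OF F[OF le(2)[OF j]]] by blast
    have "(N j ^^ nat (b - a)) v = 0" for v
    proof -
      have "(N j ^^ nat (b - a)) v \<in> ?M j (b - 2 * int (nat (b - a)))"
        by (rule funpow_shift[of "?M j" "N j", where k = b]) (use E(6)[OF j] j b in auto)
      moreover have "b - 2 * int (nat (b - a)) \<le> a \<or> b \<le> a" by linarith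
      then have "?M j (b - 2 * int (nat (b - a))) = {0}" using a by auto
      ultimately show ?thesis by simp
    qed
    then show ?thesis unfolding nilpotent_on_def by blast
  qed
  then have nilp': "nilpotent_on U (N j)" if "j \<in> {1..r}" for j U
    using that unfolding nilpotent_on_def by blast
  have diff: "N j v - N' j v \<in> ?M (j - 1) (k - 1)" if j: "j \<in> {1..r}" and v: "v \<in> ?M (j - 1) k" for j k v
    using subspace_diff[OF S[OF le(1)[OF j]] E(8)[OF j v] type_equationsD(8)[OF eqs' j v]] by simp
  have rel: "is_relative_weight_filtration UNIV (N j) (?M (j - 1)) (?M j)" if j: "j \<in> {1..r}" for j
    by (rule relative_weight_filtration_transfer[OF deligne_systemD(4)[OF D' j] N[OF j] nilp[OF j]
          E(5)[OF j le(1)[OF j]] E(6)[OF j] diff[OF j]]) (use j in auto)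
  have ws: "weight_seq W N j = ?M j" if "j \<le> r" for j
    using that
  proof (induction j)
    case (Suc j)
    then have "is_relative_weight_filtration UNIV (N (Suc j)) (weight_seq W N j) (?M (Suc j))"
      using rel[of "Suc j"] by simp
    from relative_weight_filtration_eqI[OF this] show ?case by simp
  qed simp
  have rel_sub: "is_relative_weight_filtration (?M k l) (N j)
      (\<lambda>i. ?M (j - 1) i \<inter> ?M k l) (\<lambda>i. ?M j i \<inter> ?M k l)"
    if j: "j \<in> {1..r}" and k: "k + 1 < j" for j k l
  proof (rule relative_weight_filtration_transfer[OF deligne_systemD(5)[OF D' j k] N[OF j] nilp'[OF j]])
    have kr: "k \<le> r" using j k by auto
    have Uj: "N j v \<in> ?M k l" if "v \<in> ?M k l" for v by (rule E(5)[OF j kr that])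
    show "N j v \<in> ?M (j - 1) i \<inter> ?M k l" if "v \<in> ?M (j - 1) i \<inter> ?M k l" for i v
      using that E(5)[OF j le(1)[OF j]] Uj by simp
    show "N j v \<in> ?M j (i - 2) \<inter> ?M k l" if "v \<in> ?M j i \<inter> ?M k l" for i v
      using that E(6)[OF j, of j] Uj j by simp
    show "N j v - N' j v \<in> ?M (j - 1) (i - 1) \<inter> ?M k l" if v: "v \<in> ?M (j - 1) i \<inter> ?M k l" for i v
      using v diff[OF j, of v i] subspace_diff[OF S[OF kr] Uj type_equationsD(5)[OF eqs' j kr]] by simp
  qed
  have "deligne_system r W N Y"
    unfolding deligne_system_def
  proof (intro conjI ballI allI impI)
    show "is_filtration UNIV W" by (rule deligne_systemD(1)[OF D'])
    show "is_grading (weight_seq W N r) Y"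
      using gr[of r] by (simp add: ws partial_grading_top)
    show "preserves Y (weight_seq W N j)" if "j \<in> {0..r}" for j
      using E(3)[of j] that by (auto simp: preserves_def ws)
    fix j assume j: "j \<in> {1..r}"
    note ws1 = ws[OF le(1)[OF j]] and ws2 = ws[OF le(2)[OF j]]
    show "endo (N j)" "nilpotent_on UNIV (N j)" by (rule N[OF j], rule nilp[OF j])
    show "preserves (N j) W" using E(5)[OF j, of 0] by (auto simp: preserves_def)
    show "bracket (N i) (N j) = (\<lambda>v. 0)" if "i \<in> {1..r}" for i by (rule E(4)[OF that j])
    show "bracket Y (N j) = (\<lambda>v. scale (- 2) (N j v))" by (rule E(7)[OF j])
    show "is_relative_weight_filtration UNIV (N j) (weight_seq W N (j - 1)) (weight_seq W N j)"
      unfolding ws1 ws2 by (rule rel[OF j])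
    show "N j ` weight_seq W N k l \<subseteq> weight_seq W N k l" if "k \<in> {0..r}" for k l
      using E(5)[OF j] that by (auto simp: ws)
    show "N j ` weight_seq W N k l \<subseteq> weight_seq W N k (l - 2)" if "k \<in> {j..r}" for k l
      using E(6)[OF j that] that by (auto simp: ws)
    fix k l assume k: "k + 1 < j"
    then have "k \<le> r" using j by auto
    then show "is_relative_weight_filtration (weight_seq W N k l) (N j)
        (\<lambda>i. weight_seq W N (j - 1) i \<inter> weight_seq W N k l)
        (\<lambda>i. weight_seq W N j i \<inter> weight_seq W N k l)"
      unfolding ws1 ws2 by (simp only: ws rel_sub[OF j k])
  qed
  moreover have "has_sl2_type r W N Y Nhat H"
    unfolding has_sl2_type_def
  proof (intro exI[of _ ?G] conjI ballI)
    show "?G r = Y" by (rule partial_grading_top)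
    fix j assume j: "j \<in> {1..r}"
    note ws1 = ws[OF le(1)[OF j]]
    show Hj: "H j = (\<lambda>v. ?G j v - ?G (j - 1) v)"
      using partial_grading_pred[OF j, of H Y] by (simp add: fun_eq_iff)
    show dz: "is_degree_zero_part (?G (j - 1)) (N j) (Nhat j)"
      by (rule degree_zero_partI[OF F[OF le(1)[OF j]] gr[OF le(1)[OF j]] N[OF j] Nhat[OF j] E(9)[OF j] E(8)[OF j]])
    show "is_deligne_grading (weight_seq W N (j - 1)) (N j) (?G j) (?G (j - 1))"
      unfolding is_deligne_grading_def ws1
      using gr[OF le(1)[OF j]] E(2)[OF j] dz sl2[OF j] E(10)[OF j] unfolding Hj by blast
  qed
  ultimately show ?thesis ..
qed

section \<open>Uniqueness of the raising operator\<close>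

text \<open>By the Jacobi identity, weights for \<open>ad H\<close> add up under brackets.\<close>

lemma bracket_ad_eigenvectors:
  assumes X: "endo X" and Z: "endo Z" and H: "endo H"
    and HX: "bracket H X = (\<lambda>v. scale c (X v))" and HZ: "bracket H Z = (\<lambda>v. scale e (Z v))"
  shows "bracket H (bracket X Z) = (\<lambda>v. scale (c + e) (bracket X Z v))"
proof
  fix v
  have 1: "H (X u) = X (H u) + scale c (X u)" for u
    using fun_cong[OF HX, of u] by (simp add: bracket_def algebra_simps)
  have 2: "H (Z u) = Z (H u) + scale e (Z u)" for u
    using fun_cong[OF HZ, of u] by (simp add: bracket_def algebra_simps)
  show "bracket H (bracket X Z) v = scale (c + e) (bracket X Z v)"
    unfolding bracket_def
    by (simp add: endo_diff[OF H] endo_diff[OF X] endo_diff[OF Z] 1 2 endo_add[OF X] endo_add[OF Z]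
        endo_scale[OF X] endo_scale[OF Z] scale_left_distrib scale_right_diff_distrib)
qed

end

locale char0_finite_dimensional = char0_vector_space scale + finite_dimensional_vector_space scale Basis
  for scale :: "'a::field_char_0 \<Rightarrow> 'b::ab_group_add \<Rightarrow> 'b" and Basis :: "'b set"
begin

lemma finite_eigenvalues:
  assumes Y: "endo Y"
  shows "finite {j. eigenspace Y j \<noteq> {0}}"
proof (rule ccontr)
  assume "infinite {j. eigenspace Y j \<noteq> {0}}"
  then obtain F where F: "F \<subseteq> {j. eigenspace Y j \<noteq> {0}}" "finite F" "card F = Suc (dim UNIV)"
    using infinite_arbitrarily_large by blast
  have "\<exists>x. x \<in> eigenspace Y j \<and> x \<noteq> 0" if "j \<in> F" for j
    using F(1) that subspace_0[OF subspace_eigenspace[OF Y]] by blast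
  then obtain x where x: "\<And>j. j \<in> F \<Longrightarrow> x j \<in> eigenspace Y j" "\<And>j. j \<in> F \<Longrightarrow> x j \<noteq> 0"
    by metis
  have inj: "inj_on x F"
    using x eigenspaces_disjoint[OF Y] by (intro inj_onI) metis
  have "independent (x ` F)"
  proof (subst dependent_finite)
    show "finite (x ` F)" using F(2) by simp
    show "\<not> (\<exists>u. (\<exists>v\<in>x ` F. u v \<noteq> 0) \<and> (\<Sum>v\<in>x ` F. scale (u v) v) = 0)"
    proof
      assume "\<exists>u. (\<exists>v\<in>x ` F. u v \<noteq> 0) \<and> (\<Sum>v\<in>x ` F. scale (u v) v) = 0"
      then obtain u j where u: "j \<in> F" "u (x j) \<noteq> 0" "(\<Sum>v\<in>x ` F. scale (u v) v) = 0" by blast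
      have "(\<Sum>i\<in>F. scale (u (x i)) (x i)) = 0"
        using u(3) by (simp add: sum.reindex[OF inj])
      moreover have "scale (u (x i)) (x i) \<in> eigenspace Y i" if "i \<in> F" for i
        by (intro subspace_scale subspace_eigenspace Y x(1) that)
      ultimately have "scale (u (x j)) (x j) = 0"
        using eigencomponents_zero[OF Y F(2), of "\<lambda>i. i" "\<lambda>i. scale (u (x i)) (x i)" j] u(1) by simp
      then show False using u(1,2) x(2) by simp
    qed
  qed
  then have "card (x ` F) \<le> dim UNIV"
    by (intro independent_card_le_dim) auto
  then show False using F(3) by (simp add: card_image[OF inj])
qed

text \<open>The difference \<open>Z 0\<close> of two raising operators has weight \<open>2\<close> and commutes with \<open>N\<close>.  If it
  were nonzero, then, as for a vector of positive weight killed by the lowering operator, repeated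
  application of \<open>ad P\<close> would produce nonzero endomorphisms \<open>Z n\<close> of all the weights \<open>2 n + 2\<close>, since \<open>ad N\<close> takes \<open>Z (n + 1)\<close> to a
  nonzero multiple of \<open>Z n\<close>; but \<open>H\<close> has only finitely many eigenvalues.\<close>

lemma sl2_raising_operator_unique:
  assumes P: "sl2_triple P H N" and P': "sl2_triple P' H N"
    and diag: "span (\<Union>b. eigenspace H b) = UNIV"
  shows "P = P'"
proof -
  have eP: "endo P" and eP': "endo P'" and eH: "endo H" and eN: "endo N"
    and HP: "bracket H P = (\<lambda>v. scale 2 (P v))" and PN: "bracket P N = H"
    and HP': "bracket H P' = (\<lambda>v. scale 2 (P' v))" and PN': "bracket P' N = H"
    using P P' by (auto simp: sl2_triple_def)
  define Z where "Z n = (bracket P ^^ n) (\<lambda>v. P v - P' v)" for n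
  have Z0: "Z 0 = (\<lambda>v. P v - P' v)" and Z_Suc: "Z (Suc n) = bracket P (Z n)" for n
    by (simp_all add: Z_def)
  have eZ: "endo (Z n)" for n
    by (induction n) (simp_all add: Z0 Z_Suc endo_minus_fun endo_bracket eP eP')
  have HZ: "bracket H (Z n) = (\<lambda>v. scale (of_int (2 * int n + 2)) (Z n v))" for n
  proof (induction n)
    case 0
    show ?case
    proof
      fix v
      have "bracket H (Z 0) v = bracket H P v - bracket H P' v"
        by (simp add: Z0 bracket_def endo_diff[OF eH] algebra_simps)
      then show "bracket H (Z 0) v = scale (of_int (2 * int 0 + 2)) (Z 0 v)"
        by (simp add: HP HP' Z0 scale_right_diff_distrib)
    qed
  next
    case (Suc n)
    then show ?case
      using bracket_ad_eigenvectors[OF eP eZ eH HP Suc] by (simp add: Z_Suc algebra_simps)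
  qed
  have NZ: "Z n (N v) - N (Z n v) = (if n = 0 then 0 else scale (of_nat (n * (n + 1))) (Z (n - 1) v))"
    for n v
  proof (induction n arbitrary: v)
    case 0
    have "bracket P N v = bracket P' N v" by (simp add: PN PN')
    then show ?case by (simp add: Z0 bracket_def endo_diff[OF eN] algebra_simps)
  next
    case (Suc n)
    note IH = Suc.IH
    let ?A = "\<lambda>v. Z n (N v) - N (Z n v)"
    \<comment> \<open>Jacobi identity: \<open>[[P, Z n], N] = [[P, N], Z n] + [P, [Z n, N]]\<close>, with \<open>[P, N] = H\<close>.\<close>
    have Hv: "H v = P (N v) - N (P v)" for v
      using PN by (auto simp: bracket_def)
    have "Z (Suc n) (N v) - N (Z (Suc n) v) = (H (Z n v) - Z n (H v)) + (P (?A v) - ?A (P v))"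
      by (simp add: Z_Suc bracket_def Hv endo_diff[OF eN] endo_diff[OF eP] endo_diff[OF eZ])
    also have "H (Z n v) - Z n (H v) = scale (of_int (2 * int n + 2)) (Z n v)"
      using fun_cong[OF HZ, of n v] by (simp add: bracket_def)
    also have "P (?A v) - ?A (P v) = scale (of_nat (n * (n + 1))) (Z n v)"
    proof (cases n)
      case 0
      then show ?thesis using Suc endo_zero[OF eP] by simp
    next
      case (Suc m)
      then show ?thesis
        unfolding IH
        by (simp add: Z_Suc bracket_def endo_scale[OF eP] scale_right_diff_distrib del: of_nat_mult)
    qed
    also have "scale (of_int (2 * int n + 2)) (Z n v) + scale (of_nat (n * (n + 1))) (Z n v)
        = scale (of_nat (Suc n * (Suc n + 1))) (Z n v)"
      unfolding scale_left_distrib[symmetric] by (intro arg_cong2[of _ _ _ _ scale]) (simp_all add: algebra_simps)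
    finally show ?case by simp
  qed
  \<comment> \<open>For a bound \<open>B\<close> of the eigenvalues of \<open>H\<close>, the weight of \<open>Z B\<close> is so large that \<open>Z B\<close> maps
    each eigenspace of \<open>H\<close> to a zero eigenspace.\<close>
  obtain B where B: "\<And>b. b \<in> {b. eigenspace H b \<noteq> {0}} \<Longrightarrow> \<bar>b\<bar> < int B"
  proof -
    let ?F = "{b. eigenspace H b \<noteq> {0}}"
    have "\<bar>b\<bar> < int (nat (\<Sum>i\<in>?F. \<bar>i\<bar>) + 1)" if "b \<in> ?F" for b
      using member_le_sum[OF that, of abs] finite_eigenvalues[OF eH] by simp
    then show thesis using that by blast
  qed
  have "Z B = (\<lambda>v. 0)"
  proof (rule endo_eqI_eigenspaces[OF diag eZ endo_const_zero])
    fix b x assume x: "x \<in> eigenspace H b"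
    have Zx: "Z B x \<in> eigenspace H (b + (2 * int B + 2))"
      by (rule ad_eigenvector_maps_eigenspace[OF eZ HZ x])
    show "Z B x = 0"
    proof (cases "x = 0")
      case True
      then show ?thesis using endo_zero[OF eZ] by simp
    next
      case False
      then have "\<bar>b\<bar> < int B" using B[of b] x by blast
      then have "\<not> \<bar>b + (2 * int B + 2)\<bar> < int B" by simp
      then have "eigenspace H (b + (2 * int B + 2)) = {0}" using B by blast
      then show ?thesis using Zx by simp
    qed
  qed
  moreover have "Z n = (\<lambda>v. 0)" if "Z (Suc n) = (\<lambda>v. 0)" for n
  proof
    fix v
    have "scale (of_nat (Suc n * (Suc n + 1))) (Z n v) = 0"
      using NZ[of "Suc n" v] that endo_zero[OF eN] by simp
    then show "Z n v = 0" by (metis nat.simps(3) of_nat_eq_0_iff scale_eq_0_iff mult_eq_0_iff add_eq_0_iff_both_eq_0)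
  qed
  ultimately have "Z 0 = (\<lambda>v. 0)"
  proof (induction B)
    case (Suc B)
    then show ?case by blast
  qed
  then show ?thesis by (simp add: Z0 fun_eq_iff)
qed

section \<open>Systems of the type satisfy the equations\<close>

lemma type_equations_necessary:
  assumes D: "deligne_system r W N Y" and ty: "has_sl2_type r W N Y Nhat H"
    and sl2: "\<And>j. j \<in> {1..r} \<Longrightarrow> sl2_triple (P j) (H j) (Nhat j)"
  shows "type_equations r (weight_seq W N) Nhat H P N Y"
  unfolding type_equations_def
proof (intro conjI ballI allI)
  note T = has_sl2_typeD[OF D ty] and DD = deligne_systemD[OF D]
  show "partial_grading r H Y j v - scale (of_int k) v \<in> weight_seq W N j (k - 1)"
    if "j \<in> {0..r}" "v \<in> weight_seq W N j k" for j k v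
    by (rule grading_acts_on_graded_piece[OF T(1)]) (use that in auto)
  show "Y v \<in> weight_seq W N j k" if "j \<in> {0..r}" "v \<in> weight_seq W N j k" for j k v
    by (rule DD(9)[OF that])
  fix j assume j: "j \<in> {1..r}"
  then have j1: "j - 1 \<le> r" by auto
  have pres: "N j v \<in> weight_seq W N (j - 1) k" if "v \<in> weight_seq W N (j - 1) k" for v k
    by (rule DD(6)[OF j _ that]) (use j in auto)
  note dz = degree_zero_partD[OF T(1)[OF j1] pres T(3)[OF j]]
  show "bracket (partial_grading r H Y j) (partial_grading r H Y (j - 1)) = (\<lambda>v. 0)"
    by (rule T(2)[OF j])
  show "bracket (N i) (N j) = (\<lambda>v. 0)" if "i \<in> {1..r}" for i by (rule DD(3)[OF that j])
  show "N j v \<in> weight_seq W N k l" if "k \<in> {0..r}" "v \<in> weight_seq W N k l" for k l v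
    by (rule DD(6)[OF j that])
  show "N j v \<in> weight_seq W N k (l - 2)" if "k \<in> {j..r}" "v \<in> weight_seq W N k l" for k l v
    by (rule DD(7)[OF j that])
  show "(\<lambda>v. bracket Y (N j) v - scale (- 2) (N j v)) = (\<lambda>v. 0)"
    unfolding DD(10)[OF j] by simp
  show "N j v - Nhat j v \<in> weight_seq W N (j - 1) (k - 1)" if "v \<in> weight_seq W N (j - 1) k" for k v
    by (rule dz(4)) (use that in auto)
  show "bracket (partial_grading r H Y (j - 1)) (Nhat j) = (\<lambda>v. 0)" by (rule dz(2))
  obtain P' where P': "sl2_triple P' (H j) (Nhat j)" "bracket (\<lambda>v. N j v - Nhat j v) P' = (\<lambda>v. 0)"
    using T(4)[OF j] by blast
  have "H j = (\<lambda>v. partial_grading r H Y j v - partial_grading r H Y (j - 1) v)"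
    using partial_grading_pred[OF j, of H Y] by (simp add: fun_eq_iff)
  then have "span (\<Union>b. eigenspace (H j) b) = UNIV"
    using difference_of_commuting_gradings_diagonalizable[OF T(1) T(1)[OF j1] T(2)[OF j]] j by simp
  then have "P' = P j" by (rule sl2_raising_operator_unique[OF P'(1) sl2[OF j]])
  then show "bracket (\<lambda>v. N j v - Nhat j v) (P j) = (\<lambda>v. 0)" using P'(2) by simp
qed

section \<open>Conditions defined by polynomials\<close>

definition polynomial_condition :: "nat \<Rightarrow> ((nat \<Rightarrow> 'b \<Rightarrow> 'b) \<times> ('b \<Rightarrow> 'b) \<Rightarrow> bool) \<Rightarrow> bool" where
  "polynomial_condition r Q \<longleftrightarrow> algebraic_variety r {p \<in> endo_tuples r. Q p}"

lemma polynomial_condition_ball: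
  assumes "\<And>i. i \<in> I \<Longrightarrow> polynomial_condition r (Q i)"
  shows "polynomial_condition r (\<lambda>p. \<forall>i\<in>I. Q i p)"
proof -
  have "\<forall>i\<in>I. \<exists>F. (\<forall>f\<in>F. polynomial_fun r f) \<and>
      {p \<in> endo_tuples r. Q i p} = {p \<in> endo_tuples r. \<forall>f\<in>F. f p = 0}"
    using assms unfolding polynomial_condition_def algebraic_variety_def by (rule ballI)
  from bchoice[OF this] obtain F where F: "\<forall>i\<in>I. (\<forall>f\<in>F i. polynomial_fun r f) \<and>
      {p \<in> endo_tuples r. Q i p} = {p \<in> endo_tuples r. \<forall>f\<in>F i. f p = 0}" ..
  have Q: "Q i p \<longleftrightarrow> (\<forall>f\<in>F i. f p = 0)" if "i \<in> I" "p \<in> endo_tuples r" for i p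
  proof -
    have "p \<in> {p \<in> endo_tuples r. Q i p} \<longleftrightarrow> p \<in> {p \<in> endo_tuples r. \<forall>f\<in>F i. f p = 0}"
      using F that(1) by simp
    then show ?thesis using that(2) by simp
  qed
  have "{p \<in> endo_tuples r. \<forall>i\<in>I. Q i p} = {p \<in> endo_tuples r. \<forall>f\<in>(\<Union>i\<in>I. F i). f p = 0}"
    using Q by auto
  then show ?thesis
    unfolding polynomial_condition_def algebraic_variety_def
    using F by (intro exI[of _ "\<Union>i\<in>I. F i"]) auto
qed

lemma polynomial_condition_all:
  "(\<And>i. polynomial_condition r (Q i)) \<Longrightarrow> polynomial_condition r (\<lambda>p. \<forall>i. Q i p)"
  using polynomial_condition_ball[of UNIV r Q] by simp

lemma polynomial_condition_conj:
  assumes "polynomial_condition r Q" "polynomial_condition r Q'"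
  shows "polynomial_condition r (\<lambda>p. Q p \<and> Q' p)"
proof -
  have "polynomial_condition r (\<lambda>p. \<forall>b\<in>UNIV. if b then Q p else Q' p)"
  proof (rule polynomial_condition_ball)
    show "polynomial_condition r (\<lambda>p. if b then Q p else Q' p)" for b
      using assms by (cases b) simp_all
  qed
  then show ?thesis by (simp add: all_bool_eq conj_commute)
qed

text \<open>An endomorphism depends polynomially on a point if its matrix coefficients do.  The
  restriction to \<open>endo_tuples r\<close> matters for products: expressing the matrix
  coefficients of \<open>N i (N j v)\<close> by those of \<open>N i\<close> and \<open>N j\<close> uses the linearity of \<open>N i\<close>.\<close>

definition polynomial_endo ::
    "nat \<Rightarrow> ((nat \<Rightarrow> 'b \<Rightarrow> 'b) \<times> ('b \<Rightarrow> 'b) \<Rightarrow> 'b \<Rightarrow> 'b) \<Rightarrow> bool" where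
  "polynomial_endo r A \<longleftrightarrow> (\<forall>p\<in>endo_tuples r. endo (A p)) \<and>
     (\<forall>\<phi> v. Vector_Spaces.linear scale (*) \<phi> \<longrightarrow>
        (\<exists>f. polynomial_fun r f \<and> (\<forall>p\<in>endo_tuples r. \<phi> (A p v) = f p)))"

lemma functionalD:
  assumes "Vector_Spaces.linear scale (*) \<phi>"
  shows "\<phi> (x + y) = \<phi> x + \<phi> y" "\<phi> (scale c x) = c * \<phi> x" "\<phi> 0 = 0" "\<phi> (x - y) = \<phi> x - \<phi> y"
    and "\<phi> (sum g I) = (\<Sum>i\<in>I. \<phi> (g i))"
proof -
  interpret Vector_Spaces.linear scale "(*)" \<phi> by fact
  show "\<phi> (x + y) = \<phi> x + \<phi> y" "\<phi> (scale c x) = c * \<phi> x" "\<phi> 0 = 0" "\<phi> (x - y) = \<phi> x - \<phi> y"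
    "\<phi> (sum g I) = (\<Sum>i\<in>I. \<phi> (g i))"
    by (rule add scale zero diff sum)+
qed

lemma polynomial_fun_sum:
  "finite I \<Longrightarrow> (\<And>i. i \<in> I \<Longrightarrow> polynomial_fun r (f i)) \<Longrightarrow> polynomial_fun r (\<lambda>p. \<Sum>i\<in>I. f i p)"
  by (induction I rule: finite_induct) (simp_all add: polynomial_fun.const polynomial_fun.add)

lemma polynomial_endo_coefficient:
  "polynomial_endo r A \<Longrightarrow> Vector_Spaces.linear scale (*) \<phi> \<Longrightarrow>
    \<exists>f. polynomial_fun r f \<and> (\<forall>p\<in>endo_tuples r. \<phi> (A p v) = f p)"
  by (simp add: polynomial_endo_def)

lemma polynomial_endo_const: "endo g \<Longrightarrow> polynomial_endo r (\<lambda>p. g)"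
  unfolding polynomial_endo_def using polynomial_fun.const by blast

lemma polynomial_endo_N: "j \<in> {1..r} \<Longrightarrow> polynomial_endo r (\<lambda>p. fst p j)"
  unfolding polynomial_endo_def
proof (intro conjI allI impI ballI)
  fix \<phi> v assume "j \<in> {1..r}" "Vector_Spaces.linear scale (*) \<phi>"
  then have "polynomial_fun r (\<lambda>p. \<phi> (fst p j v))" by (rule polynomial_fun.coeff_N)
  then show "\<exists>f. polynomial_fun r f \<and> (\<forall>p\<in>endo_tuples r. \<phi> (fst p j v) = f p)" by blast
qed (auto simp: endo_tuples_def)

lemma polynomial_endo_Y: "polynomial_endo r snd"
  unfolding polynomial_endo_def
proof (intro conjI allI impI ballI)
  fix \<phi> v assume "Vector_Spaces.linear scale (*) \<phi>"
  then have "polynomial_fun r (\<lambda>p. \<phi> (snd p v))" by (rule polynomial_fun.coeff_Y)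
  then show "\<exists>f. polynomial_fun r f \<and> (\<forall>p\<in>endo_tuples r. \<phi> (snd p v) = f p)" by blast
qed (auto simp: endo_tuples_def)

lemma polynomial_endo_scale:
  assumes A: "polynomial_endo r A"
  shows "polynomial_endo r (\<lambda>p v. scale c (A p v))"
  unfolding polynomial_endo_def
proof (intro conjI allI impI ballI)
  show "endo (\<lambda>v. scale c (A p v))" if "p \<in> endo_tuples r" for p
    using A that by (auto simp: polynomial_endo_def intro: endo_scale_fun)
  fix \<phi> v assume \<phi>: "Vector_Spaces.linear scale (*) \<phi>"
  obtain f where f: "polynomial_fun r f" "\<And>p. p \<in> endo_tuples r \<Longrightarrow> \<phi> (A p v) = f p"
    using polynomial_endo_coefficient[OF A \<phi>, of v] by blast
  show "\<exists>f. polynomial_fun r f \<and> (\<forall>p\<in>endo_tuples r. \<phi> (scale c (A p v)) = f p)"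
    using polynomial_fun.mult[OF polynomial_fun.const[of r c] f(1)]
    by (intro exI[of _ "\<lambda>p. c * f p"]) (simp add: functionalD(2)[OF \<phi>] f(2))
qed

lemma polynomial_endo_diff:
  assumes A: "polynomial_endo r A" and B: "polynomial_endo r B"
  shows "polynomial_endo r (\<lambda>p v. A p v - B p v)"
  unfolding polynomial_endo_def
proof (intro conjI allI impI ballI)
  show "endo (\<lambda>v. A p v - B p v)" if "p \<in> endo_tuples r" for p
    using A B that by (auto simp: polynomial_endo_def intro: endo_minus_fun)
  fix \<phi> v assume \<phi>: "Vector_Spaces.linear scale (*) \<phi>"
  obtain f where f: "polynomial_fun r f" "\<And>p. p \<in> endo_tuples r \<Longrightarrow> \<phi> (A p v) = f p"
    using polynomial_endo_coefficient[OF A \<phi>, of v] by blast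
  obtain g where g: "polynomial_fun r g" "\<And>p. p \<in> endo_tuples r \<Longrightarrow> \<phi> (B p v) = g p"
    using polynomial_endo_coefficient[OF B \<phi>, of v] by blast
  have "polynomial_fun r (\<lambda>p. f p + (- 1) * g p)"
    by (intro polynomial_fun.add polynomial_fun.mult polynomial_fun.const f g)
  then show "\<exists>f. polynomial_fun r f \<and> (\<forall>p\<in>endo_tuples r. \<phi> (A p v - B p v) = f p)"
    by (intro exI[of _ "\<lambda>p. f p + (- 1) * g p"]) (simp add: functionalD(4)[OF \<phi>] f(2) g(2))
qed

text \<open>Inserting the expansion of \<open>B p v\<close> in the basis turns \<open>\<phi> (A p (B p v))\<close> into the usual sum of
  products of coefficients for a product of matrices.\<close>

lemma polynomial_endo_comp:
  assumes A: "polynomial_endo r A" and B: "polynomial_endo r B"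
  shows "polynomial_endo r (\<lambda>p v. A p (B p v))"
  unfolding polynomial_endo_def
proof (intro conjI allI impI ballI)
  show "endo (\<lambda>v. A p (B p v))" if "p \<in> endo_tuples r" for p
    using A B that by (auto simp: polynomial_endo_def intro: endo_comp)
  fix \<phi> v assume \<phi>: "Vector_Spaces.linear scale (*) \<phi>"
  let ?\<beta> = "\<lambda>b w. representation Basis w b"
  have \<beta>: "Vector_Spaces.linear scale (*) (?\<beta> b)" for b
    by (rule linear_representation[OF independent_Basis span_Basis])
  have "\<forall>b. \<exists>f. polynomial_fun r f \<and> (\<forall>p\<in>endo_tuples r. \<phi> (A p b) = f p)"
    by (rule allI) (rule polynomial_endo_coefficient[OF A \<phi>])
  from choice[OF this] obtain f where
    "\<forall>b. polynomial_fun r (f b) \<and> (\<forall>p\<in>endo_tuples r. \<phi> (A p b) = f b p)" ..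
  then have f: "polynomial_fun r (f b)" "p \<in> endo_tuples r \<Longrightarrow> \<phi> (A p b) = f b p" for b p
    by simp_all
  have "\<forall>b. \<exists>g. polynomial_fun r g \<and> (\<forall>p\<in>endo_tuples r. ?\<beta> b (B p v) = g p)"
    by (rule allI) (rule polynomial_endo_coefficient[OF B \<beta>])
  from choice[OF this] obtain g where
    "\<forall>b. polynomial_fun r (g b) \<and> (\<forall>p\<in>endo_tuples r. ?\<beta> b (B p v) = g b p)" ..
  then have g: "polynomial_fun r (g b)" "p \<in> endo_tuples r \<Longrightarrow> ?\<beta> b (B p v) = g b p" for b p
    by simp_all
  have "\<phi> (A p (B p v)) = (\<Sum>b\<in>Basis. g b p * f b p)" if p: "p \<in> endo_tuples r" for p
  proof -
    have A': "endo (A p)" using A p by (simp add: polynomial_endo_def)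
    have "B p v = (\<Sum>b\<in>Basis. scale (?\<beta> b (B p v)) b)"
      using sum_representation_eq[OF independent_Basis _ finite_Basis order_refl, of "B p v"] span_Basis
      by simp
    then have "\<phi> (A p (B p v)) = \<phi> (A p (\<Sum>b\<in>Basis. scale (?\<beta> b (B p v)) b))"
      by (rule arg_cong)
    also have "\<dots> = (\<Sum>b\<in>Basis. ?\<beta> b (B p v) * \<phi> (A p b))"
      by (simp only: endo_sum[OF A'] endo_scale[OF A'] functionalD(2,5)[OF \<phi>])
    also have "\<dots> = (\<Sum>b\<in>Basis. g b p * f b p)"
      by (intro sum.cong refl arg_cong2[of _ _ _ _ "(*)"] f(2) g(2) p)
    finally show ?thesis .
  qed
  moreover have "polynomial_fun r (\<lambda>p. \<Sum>b\<in>Basis. g b p * f b p)"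
    by (intro polynomial_fun_sum polynomial_fun.mult f g finite_Basis)
  ultimately show "\<exists>f. polynomial_fun r f \<and> (\<forall>p\<in>endo_tuples r. \<phi> (A p (B p v)) = f p)"
    by blast
qed

lemma polynomial_endo_bracket:
  "polynomial_endo r A \<Longrightarrow> polynomial_endo r B \<Longrightarrow> polynomial_endo r (\<lambda>p. bracket (A p) (B p))"
  unfolding bracket_def
  by (rule polynomial_endo_diff[OF polynomial_endo_comp polynomial_endo_comp])

lemma polynomial_endo_partial_grading:
  assumes "\<And>i. i \<in> {1..r} \<Longrightarrow> endo (H i)"
  shows "polynomial_endo r (\<lambda>p. partial_grading r H (snd p) j)"
  unfolding partial_grading_def
proof (intro polynomial_endo_diff polynomial_endo_Y polynomial_endo_const endo_sum_fun)
  show "endo (H i)" if "i \<in> {j<..r}" for i using that by (intro assms) auto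
qed

lemma functional_separating_from_subspace:
  assumes U: "subspace U" and v: "v \<notin> U"
  obtains \<phi> where "Vector_Spaces.linear scale (*) \<phi>" "\<And>u. u \<in> U \<Longrightarrow> \<phi> u = 0" "\<phi> v \<noteq> 0"
proof -
  interpret functionals: vector_space_pair scale "(*) :: 'a \<Rightarrow> 'a \<Rightarrow> 'a"
    by unfold_locales (simp_all add: algebra_simps)
  obtain B where B: "B \<subseteq> U" "independent B" "U \<subseteq> span B"
    by (rule basis_exists[of U]) (rule that; assumption)
  have span: "span B = U" using B span_minimal[OF B(1) U] by blast
  have "independent (insert v B)"
    using B(2) v by (intro independent_insertI) (simp_all add: span)
  then obtain \<phi> where \<phi>: "Vector_Spaces.linear scale (*) \<phi>"
    "\<forall>x\<in>insert v B. \<phi> x = (if x = v then 1 else 0)"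
    using functionals.linear_independent_extend[of "insert v B" "\<lambda>x. if x = v then 1 else 0"] by blast
  have "\<phi> u = 0" if "u \<in> U" for u
  proof -
    have "u \<in> span B" using that span by simp
    then show ?thesis
    proof (induction rule: span_induct_alt)
      case base
      show ?case by (rule functionalD(3)[OF \<phi>(1)])
    next
      case (step c x y)
      then have "x \<noteq> v" using B(1) v by auto
      then show ?case using step \<phi>(2) by (simp add: functionalD(1,2)[OF \<phi>(1)])
    qed
  qed
  moreover have "\<phi> v \<noteq> 0" using \<phi>(2) by simp
  ultimately show thesis using that[OF \<phi>(1)] by blast
qed

text \<open>A subspace is the common kernel of the linear functionals that vanish on it.\<close>

lemma polynomial_condition_in_subspace:
  assumes A: "polynomial_endo r A" and U: "subspace U"
  shows "polynomial_condition r (\<lambda>p. A p v \<in> U)"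
proof -
  define \<Phi> where "\<Phi> = {\<phi>. Vector_Spaces.linear scale (*) \<phi> \<and> (\<forall>u\<in>U. \<phi> u = 0)}"
  have "\<forall>\<phi>\<in>\<Phi>. \<exists>f. polynomial_fun r f \<and> (\<forall>p\<in>endo_tuples r. \<phi> (A p v) = f p)"
    by (intro ballI polynomial_endo_coefficient[OF A]) (simp add: \<Phi>_def)
  from bchoice[OF this] obtain F where
    "\<forall>\<phi>\<in>\<Phi>. polynomial_fun r (F \<phi>) \<and> (\<forall>p\<in>endo_tuples r. \<phi> (A p v) = F \<phi> p)" ..
  then have F: "\<phi> \<in> \<Phi> \<Longrightarrow> polynomial_fun r (F \<phi>)"
    "\<phi> \<in> \<Phi> \<Longrightarrow> p \<in> endo_tuples r \<Longrightarrow> \<phi> (A p v) = F \<phi> p" for \<phi> p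
    by simp_all
  have U_iff: "w \<in> U \<longleftrightarrow> (\<forall>\<phi>\<in>\<Phi>. \<phi> w = 0)" for w
  proof
    show "\<forall>\<phi>\<in>\<Phi>. \<phi> w = 0" if "w \<in> U" using that by (auto simp: \<Phi>_def)
    show "w \<in> U" if "\<forall>\<phi>\<in>\<Phi>. \<phi> w = 0"
    proof (rule ccontr)
      assume "w \<notin> U"
      then obtain \<phi> where "Vector_Spaces.linear scale (*) \<phi>" "\<And>u. u \<in> U \<Longrightarrow> \<phi> u = 0" "\<phi> w \<noteq> 0"
        by (rule functional_separating_from_subspace[OF U]) (rule that; assumption)
      then show False using that by (auto simp: \<Phi>_def)
    qed
  qed
  have "{p \<in> endo_tuples r. A p v \<in> U} = {p \<in> endo_tuples r. \<forall>f\<in>F ` \<Phi>. f p = 0}"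
    using F(2) by (auto simp: U_iff)
  then show ?thesis
    unfolding polynomial_condition_def algebraic_variety_def
    using F(1) by (intro exI[of _ "F ` \<Phi>"]) auto
qed

lemma polynomial_condition_eq_zero:
  assumes "polynomial_endo r A"
  shows "polynomial_condition r (\<lambda>p. A p = (\<lambda>v. 0))"
proof -
  have "polynomial_condition r (\<lambda>p. \<forall>v. A p v \<in> {0})"
    by (intro polynomial_condition_all polynomial_condition_in_subspace[OF assms]) simp
  then show ?thesis by (simp add: fun_eq_iff)
qed

lemma polynomial_condition_type_equations:
  assumes M: "\<And>j k. j \<le> r \<Longrightarrow> subspace (M j k)"
    and sl2: "\<And>j. j \<in> {1..r} \<Longrightarrow> sl2_triple (P j) (H j) (Nhat j)"
  shows "polynomial_condition r (\<lambda>p. type_equations r M Nhat H P (fst p) (snd p))"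
proof -
  have P: "endo (P j)" and H: "endo (H j)" and Nhat: "endo (Nhat j)" if "j \<in> {1..r}" for j
    using sl2[OF that] by (auto simp: sl2_triple_def)
  note G = polynomial_endo_partial_grading[OF H]
  have ND: "polynomial_endo r (\<lambda>p v. fst p j v - Nhat j v)" if "j \<in> {1..r}" for j
    by (intro polynomial_endo_diff polynomial_endo_N polynomial_endo_const Nhat that)
  have Gk: "polynomial_endo r (\<lambda>p v. partial_grading r H (snd p) j v - scale c v)" for j c
    by (intro polynomial_endo_diff G polynomial_endo_const endo_scale_fun endo_ident)
  have ad: "polynomial_endo r (\<lambda>p v. bracket (snd p) (fst p j) v - scale (- 2) (fst p j v))"
    if "j \<in> {1..r}" for j
    by (intro polynomial_endo_diff polynomial_endo_scale polynomial_endo_bracket polynomial_endo_Y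
        polynomial_endo_N that)
  show ?thesis
    unfolding type_equations_def
    by (intro polynomial_condition_conj polynomial_condition_ball polynomial_condition_all
        polynomial_condition_eq_zero polynomial_condition_in_subspace polynomial_endo_bracket
        G Gk ND ad polynomial_endo_N polynomial_endo_Y polynomial_endo_const P Nhat M)
      auto
qed

theorem systems_of_sl2_type_algebraic:
  assumes "is_sl2_type r W Nhat H"
  shows "algebraic_variety r (systems_of_sl2_type r W Nhat H)"
proof -
  obtain N' Y' where D': "deligne_system r W N' Y'" and ty': "has_sl2_type r W N' Y' Nhat H"
    using assms unfolding is_sl2_type_def by blast
  have "\<exists>P. sl2_triple P (H j) (Nhat j)" if "j \<in> {1..r}" for j
    using has_sl2_typeD(4)[OF D' ty' that] by blast
  then obtain P where sl2: "\<And>j. j \<in> {1..r} \<Longrightarrow> sl2_triple (P j) (H j) (Nhat j)"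
    by metis
  let ?eqs = "type_equations r (weight_seq W N') Nhat H P"
  have iff: "deligne_system r W N Y \<and> has_sl2_type r W N Y Nhat H \<longleftrightarrow> ?eqs N Y"
    if "(N, Y) \<in> endo_tuples r" for N Y
  proof
    assume sys: "deligne_system r W N Y \<and> has_sl2_type r W N Y Nhat H"
    then have "type_equations r (weight_seq W N) Nhat H P N Y"
      by (intro type_equations_necessary sl2) auto
    moreover have "weight_seq W N j = weight_seq W N' j" if "j \<le> r" for j
      using weight_seq_determined_by_type[OF _ _ D' ty' that] sys by blast
    then have "type_equations r (weight_seq W N) Nhat H P N Y \<longleftrightarrow> ?eqs N Y"
      unfolding type_equations_def
      by (intro arg_cong2[of _ _ _ _ "(\<and>)"] ball_cong refl all_cong) auto
    ultimately show "?eqs N Y" by blast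
  next
    assume "?eqs N Y"
    then show "deligne_system r W N Y \<and> has_sl2_type r W N Y Nhat H"
      using that by (intro type_equations_sufficient[OF D' type_equations_necessary[OF D' ty' sl2] _ sl2])
        (auto simp: endo_tuples_def)
  qed
  have "systems_of_sl2_type r W Nhat H = {p \<in> endo_tuples r. ?eqs (fst p) (snd p)}"
  proof (rule set_eqI)
    fix p :: "(nat \<Rightarrow> 'b \<Rightarrow> 'b) \<times> ('b \<Rightarrow> 'b)"
    obtain N Y where p: "p = (N, Y)" by (cases p)
    show "p \<in> systems_of_sl2_type r W Nhat H \<longleftrightarrow> p \<in> {p \<in> endo_tuples r. ?eqs (fst p) (snd p)}"
      using iff[of N Y] by (auto simp: p systems_of_sl2_type_def)
  qed
  moreover have "polynomial_condition r (\<lambda>p. ?eqs (fst p) (snd p))"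
    by (rule polynomial_condition_type_equations[OF is_filtrationD(1)[OF is_filtration_weight_seq[OF D']] sl2])
  ultimately show ?thesis unfolding polynomial_condition_def by simp
qed

end

theorem theorem6p55:
  fixes scale :: "'k::field_char_0 \<Rightarrow> 'v::ab_group_add \<Rightarrow> 'v"
    and Basis :: "'v set"
    and r :: nat
    and W :: "int \<Rightarrow> 'v set"
    and Nhat H :: "nat \<Rightarrow> 'v \<Rightarrow> 'v"
  assumes "finite_dimensional_vector_space scale Basis"
    and "char0_vector_space.is_sl2_type scale r W Nhat H"
  shows "char0_vector_space.algebraic_variety scale r
           (char0_vector_space.systems_of_sl2_type scale r W Nhat H)"
proof -
  interpret finite_dimensional_vector_space scale Basis by fact
  interpret char0_finite_dimensional scale Basis
    by unfold_locales
  show ?thesis by (rule systems_of_sl2_type_algebraic[OF assms(2)])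
qed

end
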